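(* Let $W_n=\max_{k\ge 0}Y_{n,k}$ be the width of a random recursive tree of $n$ nodes, where $Y_{n,k}$ is the number of nodes at distance $k$ from the root. Then, as $n\to\infty$, $$\mathbb{E}\{W_n\}=\frac{n}{\sqrt{2\pi L_n}}\bigl(1+\Theta(L_n^{-1})\bigr).$$
   Context: $L_n:=\max\{\log n,1\}$ (natural logarithm). A recursive tree of $n$ nodes is a rooted, nonplane tree with nodes labeled $1,\dots,n$ such that labels along every path down from the root are increasing; there are $(n-1)!$ of them. A random recursive tree of $n$ nodes is chosen uniformly among these. Equivalently: start with a root labeled $1$; for $i=2,\dots,n$, node $i$ is attached to a node chosen uniformly at random among the previous $i-1$ nodes. The root is at level $0$. *)

theory Defs
  imports "HOL-Probability.Probability" "HOL-Library.Landau_Symbols"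
begin

(* A rooted nonplane tree on the vertex set V is a pair (r, E) of its root and its set of arcs;
   an arc (u, v) says that u is the parent of v. *)
definition rooted_tree_on :: "'a set \<Rightarrow> 'a \<times> ('a \<times> 'a) set \<Rightarrow> bool" where
  "rooted_tree_on V = (\<lambda>(r, E). r \<in> V \<and> E \<subseteq> V \<times> V \<and>
     (\<forall>u. (u, r) \<notin> E) \<and> (\<forall>v\<in>V - {r}. \<exists>!u. (u, v) \<in> E) \<and> (\<forall>v\<in>V. (r, v) \<in> E\<^sup>*))"

definition recursive_trees :: "nat \<Rightarrow> (nat \<times> (nat \<times> nat) set) set" where
  "recursive_trees n = {(r, E). rooted_tree_on {1..n} (r, E) \<and> (\<forall>(u, v)\<in>E. u < v)}"

definition root_distance :: "'a \<times> ('a \<times> 'a) set \<Rightarrow> 'a \<Rightarrow> nat" where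
  "root_distance = (\<lambda>(r, E) v. LEAST k. (r, v) \<in> E ^^ k)"

definition profile :: "nat \<Rightarrow> nat \<times> (nat \<times> nat) set \<Rightarrow> nat \<Rightarrow> nat" where
  "profile n t k = card {v \<in> {1..n}. root_distance t v = k}"

(* The maximum is over all k; the range is a finite set, as profile n t k is at most n. *)
definition width :: "nat \<Rightarrow> nat \<times> (nat \<times> nat) set \<Rightarrow> nat" where
  "width n t = (MAX k. profile n t k)"

(* The uniform distribution; meaningful only for n \<ge> 1, see recursive_trees_finite_nonempty. *)
definition random_recursive_tree :: "nat \<Rightarrow> (nat \<times> (nat \<times> nat) set) pmf" where
  "random_recursive_tree n = pmf_of_set (recursive_trees n)"

definition expected_width :: "nat \<Rightarrow> real" where
  "expected_width n = measure_pmf.expectation (random_recursive_tree n) (\<lambda>t. real (width n t))"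

definition L :: "nat \<Rightarrow> real" where
  "L n = max (ln (real n)) 1"

(* The equivalent description by attachment: node i chooses its parent p i among the earlier nodes. *)
lemma bij_betw_attachment_recursive_trees:
  assumes "n \<ge> 1"
  shows "bij_betw (\<lambda>p. (1, {(p i, i) | i. i \<in> {2..n}})) (PiE {2..n} (\<lambda>i. {1..<i})) (recursive_trees n)"
proof (rule bij_betwI')
  fix p q :: "nat \<Rightarrow> nat"
  assume p: "p \<in> PiE {2..n} (\<lambda>i. {1..<i})" and q: "q \<in> PiE {2..n} (\<lambda>i. {1..<i})"
  show "((1::nat, {(p i, i) |i. i \<in> {2..n}}) = (1, {(q i, i) |i. i \<in> {2..n}})) = (p = q)"
  proof
    assume "(1::nat, {(p i, i) |i. i \<in> {2..n}}) = (1, {(q i, i) |i. i \<in> {2..n}})"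
    then have "\<And>i. i \<in> {2..n} \<Longrightarrow> p i = q i" by blast
    then show "p = q" using PiE_ext[OF p q] by blast
  qed simp
next
  fix p :: "nat \<Rightarrow> nat"
  assume p: "p \<in> PiE {2..n} (\<lambda>i. {1..<i})"
  let ?E = "{(p i, i) |i. i \<in> {2..n}}"
  have pi: "1 \<le> p i \<and> p i < i" if "i \<in> {2..n}" for i using PiE_mem[OF p that] by simp
  have reach: "v \<in> {1..n} \<Longrightarrow> (1, v) \<in> ?E\<^sup>*" for v
  proof (induction v rule: less_induct)
    case (less v)
    show ?case
    proof (cases "v = 1")
      case False
      then have v: "v \<in> {2..n}" using less.prems by auto
      then have "(1, p v) \<in> ?E\<^sup>*" using less.IH[of "p v"] pi[OF v] by auto
      moreover have "(p v, v) \<in> ?E" using v by blast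
      ultimately show ?thesis by (rule rtrancl_into_rtrancl)
    qed simp
  qed
  have "?E \<subseteq> {1..n} \<times> {1..n}" using pi by fastforce
  moreover have "\<forall>v\<in>{1..n} - {1}. \<exists>!u. (u, v) \<in> ?E" by auto
  moreover have "\<forall>(u, v)\<in>?E. u < v" using pi by blast
  ultimately show "(1, ?E) \<in> recursive_trees n"
    using assms reach by (auto simp: recursive_trees_def rooted_tree_on_def)
next
  fix t assume t: "t \<in> recursive_trees n"
  obtain r E where rE: "t = (r, E)" by (cases t)
  have r: "r \<in> {1..n}" and sub: "E \<subseteq> {1..n} \<times> {1..n}" and nr: "\<And>u. (u, r) \<notin> E"
    and uniq: "\<And>v. v \<in> {1..n} - {r} \<Longrightarrow> \<exists>!u. (u, v) \<in> E" and inc: "\<And>u v. (u, v) \<in> E \<Longrightarrow> u < v"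
    using t by (auto simp: rE recursive_trees_def rooted_tree_on_def)
  have r1: "r = 1"
  proof (rule ccontr)
    assume "r \<noteq> 1"
    then obtain u where u: "(u, 1) \<in> E" using uniq[of 1] assms by auto
    then have "u < 1" "u \<in> {1..n}" using inc sub by blast+
    then show False by auto
  qed
  define p where "p = (\<lambda>i\<in>{2..n}. THE u. (u, i) \<in> E)"
  have pE: "(p i, i) \<in> E" if i: "i \<in> {2..n}" for i
    using theI'[OF uniq[of i]] i by (simp add: p_def r1)
  have "p \<in> PiE {2..n} (\<lambda>i. {1..<i})"
    using pE sub inc by (fastforce simp: p_def intro!: PiE_I)
  moreover have "E = {(p i, i) |i. i \<in> {2..n}}"
  proof (intro equalityI subsetI)
    fix e assume e: "e \<in> E"
    obtain u v where uv: "e = (u, v)" by (cases e)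
    have v: "v \<in> {1..n}" "v \<noteq> 1" using e sub nr r1 by (auto simp: uv)
    then have v2: "v \<in> {2..n}" by auto
    have "u = p v" using uniq[of v] v r1 e pE[OF v2] by (auto simp: uv)
    then show "e \<in> {(p i, i) |i. i \<in> {2..n}}" using v2 by (auto simp: uv)
  qed (use pE in auto)
  ultimately show "\<exists>p\<in>PiE {2..n} (\<lambda>i. {1..<i}). t = (1, {(p i, i) |i. i \<in> {2..n}})"
    by (auto simp: rE r1)
qed

lemma card_recursive_trees:
  assumes "n \<ge> 1"
  shows "card (recursive_trees n) = fact (n - 1)"
proof -
  have "card (recursive_trees n) = card (PiE {2..n} (\<lambda>i. {1..<i}))"
    using bij_betw_same_card[OF bij_betw_attachment_recursive_trees[OF assms]] by simp
  also have "\<dots> = (\<Prod>i\<in>{2..n}. i - 1)" by (simp add: card_PiE)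
  also have "\<dots> = (\<Prod>i\<in>{1..n - 1}. i)"
    by (rule prod.reindex_bij_witness[of _ Suc "\<lambda>i. i - 1"]) auto
  finally show ?thesis by (simp add: fact_prod)
qed

lemma recursive_trees_finite_nonempty:
  assumes "n \<ge> 1"
  shows "finite (recursive_trees n)" "recursive_trees n \<noteq> {}"
  using card_recursive_trees[OF assms] by (auto intro: card_ge_0_finite)

end

theory Submission
  imports Defs "HOL-Real_Asymp.Real_Asymp"
begin

text \<open>
  Encode a tree by its level polynomial P(z), the sum of z^depth(v) over all nodes v.

  Upper bound. The level sizes are the Fourier coefficients of P on the unit circle, so the width is at most the mean
  of |P| over the circle, and no supremum over levels is left. For |z| = 1 attaching node n + 1
  gives E|P|^2 the exact recursion a_{n+1} = a_n (1 + 2 Re z / n) + 1, whence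
  (E|P|^2)^(1/2) \<le> n exp(-(ln n - 5/2)(1 - cos t)) for z = e^{it} near 1, and Laplace's method
  applies to the integral over t.

  Lower bound. The expected width is at least the mean size of any fixed level. With w = z - 1,
  the mean of P/n is the product of 1 + w/j over 2 \<le> j \<le> n, which is
  e^{lw} (1 - s w^2/2 + O(|w|^3)) where l and s are the sums of 1/j and 1/j^2. Hence the mean
  level sizes are Poisson(l) weights corrected by their second difference. At level floor(l) the
  correction gains a factor of about 1 + s/(2l), where s/2 > 27/100, whereas the Poisson weight there loses
  at most the factor 1 - 1/(4(l - 1)) against 1/sqrt(2 pi l). The gain wins, and l \<le> ln n.
\<close>

section \<open>Level sizes of a random attachment\<close>

text \<open>The guard makes the recursion terminate for every function \<open>p\<close>. The default
  0 is the right value at the root 1, which has no admissible parent.\<close>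

fun depth :: "(nat \<Rightarrow> nat) \<Rightarrow> nat \<Rightarrow> nat" where
  "depth p v = (if 1 \<le> p v \<and> p v < v then Suc (depth p (p v)) else 0)"

declare depth.simps [simp del]

abbreviation attachments :: "nat \<Rightarrow> (nat \<Rightarrow> nat) set" where
  "attachments n \<equiv> PiE {2..n} (\<lambda>i. {1..<i})"

definition level_size :: "nat \<Rightarrow> (nat \<Rightarrow> nat) \<Rightarrow> nat \<Rightarrow> nat" where
  "level_size n p k = card {v \<in> {1..n}. depth p v = k}"

definition level_poly :: "nat \<Rightarrow> (nat \<Rightarrow> nat) \<Rightarrow> 'a::comm_semiring_1 \<Rightarrow> 'a" where
  "level_poly n p z = (\<Sum>v=1..n. z ^ depth p v)"

lemma depth_le: "depth p v \<le> v"
proof (induction v rule: less_induct)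
  case (less v)
  then show ?case by (subst depth.simps) (auto intro: less_le_trans Suc_leI le_less_trans)
qed

lemma depth_attach_less:
  assumes "v < m"
  shows "depth (p(m := i)) v = depth p v"
  using assms
proof (induction v rule: less_induct)
  case (less v)
  then have "depth (p(m := i)) (p v) = depth p (p v)" if "p v < v"
    using that less by (auto simp del: fun_upd_apply)
  then show ?case
    using less.prems by (subst (1 2) depth.simps) (auto simp del: fun_upd_apply simp: fun_upd_other)
qed

text \<open>Every node except 1 has exactly one incoming arc, so a walk from the root can be
  retraced from its end in one way only and has just one possible length. This resolves the
  \<open>LEAST\<close> in \<open>root_distance\<close>.\<close>

lemma root_path_iff_depth:
  assumes p: "p \<in> attachments n" and v: "v \<in> {1..n}"
  shows "(1, v) \<in> {(p i, i) | i. i \<in> {2..n}} ^^ k \<longleftrightarrow> k = depth p v"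
  using v
proof (induction v arbitrary: k rule: less_induct)
  case (less v)
  let ?E = "{(p i, i) | i. i \<in> {2..n}}"
  show ?case
  proof (cases "v = 1")
    case True
    have "depth p v = 0" using True by (subst depth.simps) auto
    moreover have "(1, v) \<in> ?E ^^ k \<longleftrightarrow> k = 0" using True by (cases k) auto
    ultimately show ?thesis by simp
  next
    case False
    then have v: "v \<in> {2..n}" using less.prems by auto
    have pv: "1 \<le> p v" "p v < v" using PiE_mem[OF p v] by auto
    have d: "depth p v = Suc (depth p (p v))" using pv by (subst depth.simps) auto
    show ?thesis
    proof (cases k)
      case 0
      then show ?thesis using d False by auto
    next
      case (Suc m)
      have "(1, v) \<in> ?E ^^ k \<longleftrightarrow> (1, p v) \<in> ?E ^^ m" using v Suc by auto
      also have "\<dots> \<longleftrightarrow> m = depth p (p v)" using less.IH[of "p v" m] pv v by auto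
      finally show ?thesis using d Suc by simp
    qed
  qed
qed

lemma profile_attachment:
  assumes "p \<in> attachments n"
  shows "profile n (1, {(p i, i) | i. i \<in> {2..n}}) = level_size n p"
proof -
  let ?E = "{(p i, i) | i. i \<in> {2..n}}"
  have "root_distance (1, ?E) v = depth p v" if "v \<in> {1..n}" for v
    using root_path_iff_depth[OF assms that] by (simp only: root_distance_def prod.case Least_eq_0 Least_equality order_refl)
  then have "(v \<in> {1..n} \<and> root_distance (1, ?E) v = k) = (v \<in> {1..n} \<and> depth p v = k)" for v k
    by (rule conj_cong[OF refl arg_cong[where f = "\<lambda>x. x = k"]])
  then show ?thesis
    by (intro ext) (simp only: profile_def level_size_def)
qed

lemma expected_width_attachments:
  assumes "n \<ge> 1"
  shows "expected_width n = (\<Sum>p\<in>attachments n. real (MAX k. level_size n p k)) / fact (n - 1)"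
proof -
  have "expected_width n = (\<Sum>t\<in>recursive_trees n. real (width n t)) / fact (n - 1)"
    unfolding expected_width_def random_recursive_tree_def
    using recursive_trees_finite_nonempty[OF assms]
    by (simp add: integral_pmf_of_set card_recursive_trees[OF assms])
  also have "(\<Sum>t\<in>recursive_trees n. real (width n t)) =
    (\<Sum>p\<in>attachments n. real (width n (1, {(p i, i) | i. i \<in> {2..n}})))"
    by (rule sum.reindex_bij_betw[symmetric, OF bij_betw_attachment_recursive_trees[OF assms]])
  also have "\<dots> = (\<Sum>p\<in>attachments n. real (MAX k. level_size n p k))"
    by (rule sum.cong[OF refl]) (simp only: width_def profile_attachment)
  finally show ?thesis .
qed

lemma level_size_le: "level_size n p k \<le> n"
  unfolding level_size_def using card_mono[of "{1..n}" "{v \<in> {1..n}. depth p v = k}"] by (simp add: subset_iff)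

lemma finite_range_level_size: "finite (range (level_size n p))"
  by (rule finite_subset[of _ "{..n}"]) (auto simp: level_size_le)

lemma level_size_eq_0:
  assumes "k > n"
  shows "level_size n p k = 0"
proof -
  have "depth p v \<noteq> k" if "v \<in> {1..n}" for v
    using depth_le[of p v] that assms by simp
  then have "{v \<in> {1..n}. depth p v = k} = {}" by (simp only: Collect_empty_eq) simp
  then show ?thesis by (simp only: level_size_def card.empty)
qed

lemma card_attachments: 
  assumes "n \<ge> 1"
  shows "card (attachments n) = fact (n - 1)"
  using bij_betw_same_card[OF bij_betw_attachment_recursive_trees[OF assms]] card_recursive_trees[OF assms]
  by simp

section \<open>Generating functions under one attachment step\<close>

lemma sum_attachments_Suc:
  assumes "n \<ge> 1"
  shows "(\<Sum>p\<in>attachments (Suc n). F p) = (\<Sum>p\<in>attachments n. \<Sum>i=1..n. F (p(Suc n := i)))"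
proof -
  have eq: "{2..Suc n} = insert (Suc n) {2..n}" using assms by auto
  have int: "{1..<Suc n} = {1..n}" by auto
  have "(\<Sum>p\<in>attachments (Suc n). F p) =
    (\<Sum>(i, p)\<in>{1..<Suc n} \<times> attachments n. F (p(Suc n := i)))"
    unfolding eq PiE_insert_eq
    by (subst sum.reindex[OF inj_combinator]) (auto simp: o_def case_prod_unfold)
  also have "\<dots> = (\<Sum>i=1..n. \<Sum>p\<in>attachments n. F (p(Suc n := i)))"
    unfolding int by (rule sum.cartesian_product[symmetric])
  also have "\<dots> = (\<Sum>p\<in>attachments n. \<Sum>i=1..n. F (p(Suc n := i)))"
    by (rule sum.swap)
  finally show ?thesis .
qed

lemma level_poly_attach:
  assumes "i \<in> {1..n}"
  shows "level_poly (Suc n) (p(Suc n := i)) z = level_poly n p z + z * z ^ depth p i"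
proof -
  have "depth (p(Suc n := i)) (Suc n) = Suc (depth (p(Suc n := i)) i)"
    using assms by (subst depth.simps) auto
  then have "depth (p(Suc n := i)) (Suc n) = Suc (depth p i)"
    using assms by (simp add: depth_attach_less)
  moreover have "(\<Sum>v=1..n. z ^ depth (p(Suc n := i)) v) = (\<Sum>v=1..n. z ^ depth p v)"
    by (rule sum.cong) (simp_all add: depth_attach_less)
  ultimately show ?thesis by (simp add: level_poly_def)
qed

lemma level_poly_eq_sum_level_size:
  "level_poly n p z = (\<Sum>k\<le>n. of_nat (level_size n p k) * z ^ k)"
proof -
  have "level_poly n p z = (\<Sum>k\<le>n. \<Sum>v\<in>{v. v \<in> {1..n} \<and> depth p v = k}. z ^ depth p v)"
    unfolding level_poly_def
    by (intro sum.group[symmetric]) (auto intro: order.trans[OF depth_le])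
  also have "\<dots> = (\<Sum>k\<le>n. of_nat (level_size n p k) * z ^ k)"
    unfolding level_size_def by (intro sum.cong refl) simp
  finally show ?thesis .
qed

text \<open>Summed over all parents i of a new node, the terms \<open>z * z ^ depth p i\<close> add
  up to z times the level polynomial itself. Hence attaching node n + 1 multiplies the total by n +
  z.\<close>

lemma sum_level_poly:
  fixes z :: "'a::comm_semiring_1"
  assumes "n \<ge> 1"
  shows "(\<Sum>p\<in>attachments n. level_poly n p z) = (\<Prod>j=1..<n. of_nat j + z)"
  using assms
proof (induction n rule: dec_induct)
  case base
  have "depth p 1 = 0" for p by (subst depth.simps) auto
  then show ?case by (simp add: level_poly_def)
next
  case (step n)
  have "(\<Sum>p\<in>attachments (Suc n). level_poly (Suc n) p z) =
    (\<Sum>p\<in>attachments n. \<Sum>i=1..n. level_poly n p z + z * z ^ depth p i)"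
    unfolding sum_attachments_Suc[OF step.hyps(1)]
    by (intro sum.cong refl level_poly_attach)
  also have "\<dots> = (\<Sum>p\<in>attachments n. (of_nat n + z) * level_poly n p z)"
    by (intro sum.cong refl)
      (simp add: sum.distrib level_poly_def sum_distrib_left[symmetric] distrib_right)
  also have "\<dots> = (of_nat n + z) * (\<Prod>j=1..<n. of_nat j + z)"
    unfolding sum_distrib_left[symmetric] step.IH ..
  finally show ?case using step.hyps by (simp add: prod.atLeastLessThan_Suc mult.commute)
qed

section \<open>The second moment of the level polynomial on the unit circle\<close>

fun second_moment :: "real \<Rightarrow> nat \<Rightarrow> real" where
  "second_moment c 0 = 0"
| "second_moment c (Suc n) = (if n = 0 then 1 else second_moment c n * (1 + 2 * c / n) + 1)"

lemma cmod_add_power2: "(cmod (a + b))\<^sup>2 = (cmod a)\<^sup>2 + 2 * Re (cnj a * b) + (cmod b)\<^sup>2"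
  unfolding cmod_power2 by (simp add: power2_eq_square algebra_simps)

text \<open>Expand |P + z z^d|^2 with |z| = 1: the new term contributes 1, and the cross terms,
  summed over all parents, give 2 Re (conj P * z P) = 2 cos t |P|^2. So the mean of |P|^2 satisfies
  a recursion that involves no other moment.\<close>

lemma sum_cmod_level_poly:
  assumes "n \<ge> 1"
  shows "(\<Sum>p\<in>attachments n. (cmod (level_poly n p (cis t)))\<^sup>2) / fact (n - 1) = second_moment (cos t) n"
  using assms
proof (induction n rule: dec_induct)
  case base
  have "depth p 1 = 0" for p by (subst depth.simps) auto
  then show ?case by (simp add: level_poly_def)
next
  case (step n)
  let ?S = "\<Sum>p\<in>attachments n. (cmod (level_poly n p (cis t)))\<^sup>2"
  have inner: "(\<Sum>i=1..n. (cmod (level_poly n p (cis t) + cis t * cis t ^ depth p i))\<^sup>2) =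
      (cmod (level_poly n p (cis t)))\<^sup>2 * (n + 2 * cos t) + n" for p
  proof -
    let ?P = "level_poly n p (cis t)"
    have "(\<Sum>i=1..n. (cmod (?P + cis t * cis t ^ depth p i))\<^sup>2) =
      (\<Sum>i=1..n. (cmod ?P)\<^sup>2 + 1 + 2 * Re (cnj ?P * (cis t * cis t ^ depth p i)))"
      by (simp only: cmod_add_power2 norm_mult norm_power norm_cis) (simp add: add_ac)
    also have "\<dots> = n * (cmod ?P)\<^sup>2 + n + 2 * (\<Sum>i=1..n. Re (cnj ?P * (cis t * cis t ^ depth p i)))"
      by (simp only: sum.distrib sum_distrib_left[symmetric]) (simp add: algebra_simps)
    also have "(\<Sum>i=1..n. Re (cnj ?P * (cis t * cis t ^ depth p i))) = Re (cnj ?P * (cis t * ?P))"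
      by (simp only: Re_sum[symmetric] sum_distrib_left[symmetric] level_poly_def)
    also have "cnj ?P * (cis t * ?P) = cis t * of_real ((cmod ?P)\<^sup>2)"
      by (simp only: complex_norm_square of_real_mult) (simp only: mult_ac)
    finally show ?thesis by (simp add: algebra_simps)
  qed
  have "(\<Sum>p\<in>attachments (Suc n). (cmod (level_poly (Suc n) p (cis t)))\<^sup>2) =
    (\<Sum>p\<in>attachments n. \<Sum>i=1..n. (cmod (level_poly n p (cis t) + cis t * cis t ^ depth p i))\<^sup>2)"
    unfolding sum_attachments_Suc[OF step.hyps(1)]
    by (intro sum.cong refl arg_cong[where f = "\<lambda>x. (cmod x)\<^sup>2"] level_poly_attach)
  also have "\<dots> = ?S * (n + 2 * cos t) + n * fact (n - 1)"
    unfolding inner sum.distrib using card_attachments[OF step.hyps(1)] by (simp add: sum_distrib_right del: One_nat_def)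
  finally have eq: "(\<Sum>p\<in>attachments (Suc n). (cmod (level_poly (Suc n) p (cis t)))\<^sup>2) =
    ?S * (n + 2 * cos t) + n * fact (n - 1)" .
  have divide_eq: "(S * (m + 2 * c) + m * f) / (m * f) = S / f * (1 + 2 * c / m) + 1"
    if "m > 0" "f > 0" for S m c f :: real
    using that by (simp add: field_simps)
  have fact_n: "fact n = real n * fact (n - 1)"
    using step.hyps by (intro fact_reduce) simp
  have "(?S * (n + 2 * cos t) + n * fact (n - 1)) / fact n = ?S / fact (n - 1) * (1 + 2 * cos t / n) + 1"
    unfolding fact_n of_nat_mult of_nat_fact using step.hyps by (intro divide_eq) auto
  moreover have "second_moment (cos t) (Suc n) = second_moment (cos t) n * (1 + 2 * cos t / n) + 1"
    using step.hyps by simp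
  ultimately show ?case
    unfolding eq diff_Suc_1 step.IH by (rule trans[OF _ sym])
qed

lemma second_moment_Suc:
  "n \<ge> 1 \<Longrightarrow> second_moment c (Suc n) = second_moment c n * (1 + 2 * c / n) + 1"
  by simp

declare second_moment.simps(2) [simp del]

lemma second_moment_1: "second_moment c 1 = 1"
  by (simp add: second_moment.simps)

lemma second_moment_2: "second_moment c 2 = 2 + 2 * c"
  using second_moment_Suc[of 1 c] second_moment_1[of c] by (simp add: numeral_2_eq_2)

lemma second_moment_mono:
  assumes "-1 \<le> c" "c \<le> d" "n \<ge> 1"
  shows "0 \<le> second_moment c n \<and> second_moment c n \<le> second_moment d n"
proof (cases "n = 1")
  case True
  then show ?thesis by (simp only: second_moment_1) simp
next
  case False
  \<comment> \<open>The factor 1 + 2c/n may be negative at n = 1. From n = 2 on it is nonnegative,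
    and the value 2 + 2c there is nonnegative too, so the induction starts at 2.\<close>
  then have "n \<ge> 2" using assms by simp
  then show ?thesis
  proof (induction n rule: dec_induct)
    case base
    then show ?case using assms by (simp add: second_moment_2)
  next
    case (step n)
    have "0 \<le> 1 + 2 * c / n" "1 + 2 * c / n \<le> 1 + 2 * d / n"
      using step.hyps assms by (auto simp: field_simps)
    then show ?case
      using step.hyps step.IH by (simp add: second_moment_Suc mult_mono)
  qed
qed

text \<open>The linear recursion has the particular solution -n/(2c - 1) and the product as
  homogeneous solution; the value 1 at n = 1 fixes the coefficient. Multiplying by 2c - 1 keeps the
  identity valid at c = 1/2.\<close>

lemma second_moment_closed_form:
  assumes "n \<ge> 1"
  shows "second_moment c n * (2 * c - 1) = 2 * c * (\<Prod>j=1..<n. 1 + 2 * c / real j) - n"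
  using assms
proof (induction n rule: dec_induct)
  case base
  then show ?case by (simp only: second_moment_1) simp
next
  case (step n)
  let ?b = "\<Prod>j=1..<n. 1 + 2 * c / real j"
  have distrib: "(s * (1 + x) + 1) * (2 * c - 1) = s * (2 * c - 1) * (1 + x) + 2 * c - 1" for s x :: real
    by (simp add: algebra_simps)
  have "second_moment c (Suc n) * (2 * c - 1) =
    (second_moment c n * (2 * c - 1)) * (1 + 2 * c / n) + 2 * c - 1"
    using step.hyps distrib[of _ "2 * c / n"] by (simp only: second_moment_Suc)
  also have "\<dots> = 2 * c * (?b * (1 + 2 * c / n)) - Suc n"
    unfolding step.IH using step.hyps by (simp add: field_simps)
  finally show ?case using step.hyps by (simp add: prod.atLeastLessThan_Suc)
qed

text \<open>At u = 0 the product telescopes to n(n + 1)/2. In general the factor at j is (j + 2)/j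
  times 1 - 2u/(j + 2) \<le> exp (-2u/(j + 2)), and the 1/(j + 2) with 1 \<le> j < n sum to
  \<open>harm (n + 1) - 3 / 2\<close>.\<close>

lemma prod_second_moment_le:
  fixes u :: real
  assumes u: "0 \<le> u" "u \<le> 1/2" and n: "n \<ge> 1"
  shows "(\<Prod>j=1..<n. 1 + 2 * (1 - u) / real j) \<le> real n * (real n + 1) / 2 * exp (- 2 * u * (harm (n + 1) - 3 / 2))"
  using n
proof (induction n rule: dec_induct)
  case base
  have "harm (1 + 1) = (3 / 2 :: real)" by (simp add: harm_def)
  then show ?case by (simp only: diff_self) simp
next
  case (step n)
  let ?e = "\<lambda>n. exp (- 2 * u * (harm (n + 1) - 3 / 2))"
  have e: "?e (Suc n) = ?e n * exp (- (2 * u / (n + 2)))"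
    by (simp add: exp_add[symmetric] harm_Suc[of "Suc n"] field_simps)
  have "1 + 2 * (1 - u) / real n = (n + 2) / n * (1 - 2 * u / (n + 2))"
    using step.hyps by (simp add: divide_simps)
  also have "\<dots> \<le> (n + 2) / n * exp (- (2 * u / (n + 2)))"
    using exp_ge_add_one_self[of "- (2 * u / (n + 2))"] by (intro mult_left_mono) auto
  finally have le: "1 + 2 * (1 - u) / real n \<le> (n + 2) / n * exp (- (2 * u / (n + 2)))" .
  have "(\<Prod>j=1..<Suc n. 1 + 2 * (1 - u) / real j) = (\<Prod>j=1..<n. 1 + 2 * (1 - u) / real j) * (1 + 2 * (1 - u) / n)"
    using step.hyps by (simp add: prod.atLeastLessThan_Suc)
  also have "\<dots> \<le> (real n * (real n + 1) / 2 * ?e n) * ((n + 2) / n * exp (- (2 * u / (n + 2))))"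
    using u by (intro mult_mono step.IH le) (auto intro!: add_nonneg_nonneg)
  also have "\<dots> = real (Suc n) * (real (Suc n) + 1) / 2 * ?e (Suc n)"
    unfolding e using step.hyps by (simp add: field_simps)
  finally show ?case .
qed

text \<open>The closed form is divided by 2c - 1 = 1 - 2u > 0. In the constant 5/2, the part 3/2
  comes from the harmonic sum and the part 1 from (1 - u)/(1 - 2u) \<le> 1 + 2u \<le> exp (2u),
  valid for u \<le> 1/4.\<close>

lemma second_moment_le:
  fixes u :: real
  assumes u: "0 \<le> u" "u \<le> 1/4" and n: "n \<ge> 1"
  shows "second_moment (1 - u) n \<le> (real n)\<^sup>2 * exp (- 2 * u * (ln n - 5 / 2))"
proof -
  let ?b = "\<Prod>j=1..<n. 1 + 2 * (1 - u) / real j"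
  define h where "h = harm (n + 1) - (3 / 2 :: real)"
  define E where "E = exp (- 2 * u * h)"
  have "harm 2 \<le> (harm (n + 1) :: real)" using n by (intro harm_mono) simp
  then have h0: "h \<ge> 0" by (simp add: h_def harm_expand)
  have hl: "h \<ge> ln n - 3 / 2"
  proof -
    have "ln (real n) \<le> ln (real (n + 1) + 1)" using n by simp
    also have "\<dots> \<le> harm (n + 1)" by (rule ln_le_harm)
    finally show ?thesis by (simp add: h_def)
  qed
  have E: "0 \<le> E" "E \<le> 1" using u h0 by (simp_all add: E_def)
  have "(1 - u) * E \<le> 1 * 1" using u E by (intro mult_mono) auto
  then have E': "real n * ((1 - u) * E) \<le> real n * 1" by (intro mult_left_mono) auto
  have "second_moment (1 - u) n * (1 - 2 * u) = 2 * (1 - u) * ?b - n"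
    using second_moment_closed_form[OF n, of "1 - u"] by (simp add: algebra_simps)
  also have "\<dots> \<le> 2 * (1 - u) * (real n * (real n + 1) / 2 * E) - n"
    using prod_second_moment_le[of u n, folded h_def, folded E_def] u n
    by (intro diff_mono mult_left_mono) simp_all
  also have "\<dots> = (real n)\<^sup>2 * E * (1 - u) + (n * ((1 - u) * E) - n)"
    by (simp add: power2_eq_square field_simps)
  \<comment> \<open>The lower-order part of n(n + 1) is absorbed by the \<open>- n\<close> of the
    closed form, so the leading constant stays 1.\<close>
  also have "\<dots> \<le> (real n)\<^sup>2 * E * (1 - u)"
    using E' by simp
  also have "\<dots> \<le> (real n)\<^sup>2 * E * ((1 + 2 * u) * (1 - 2 * u))"
  proof (rule mult_left_mono)
    have "u * (1 - 4 * u) \<ge> 0" using u by simp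
    then show "1 - u \<le> (1 + 2 * u) * (1 - 2 * u)" by (simp add: algebra_simps)
  qed (use E in simp)
  finally have "second_moment (1 - u) n \<le> (real n)\<^sup>2 * E * (1 + 2 * u)"
    using u by (simp add: mult.assoc[symmetric])
  also have "\<dots> \<le> (real n)\<^sup>2 * E * exp (2 * u)"
    using E by (intro mult_left_mono) auto
  also have "\<dots> = (real n)\<^sup>2 * exp (- 2 * u * (h - 1))"
    by (simp add: E_def exp_add[symmetric] algebra_simps)
  also have "\<dots> \<le> (real n)\<^sup>2 * exp (- 2 * u * (ln n - 5 / 2))"
    using u hl by (intro mult_left_mono) (auto intro: mult_left_mono)
  finally show ?thesis .
qed

text \<open>For cos t \<ge> 3/4 the previous bound applies with u = 1 - cos t. Elsewhere
  monotonicity in c reduces to u = 1/4, which yields the second exponential; adding both covers all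
  t.\<close>

lemma sqrt_second_moment_le:
  assumes n: "n \<ge> 1"
  shows "sqrt (second_moment (cos t) n) \<le>
    n * (exp (- (ln n - 5 / 2) * (1 - cos t)) + exp (- (ln n - 5 / 2) / 4))"
proof -
  let ?l = "ln n - 5 / 2 :: real"
  have key: "sqrt (second_moment (1 - u) n) \<le> n * exp (- ?l * u)" if "0 \<le> u" "u \<le> 1/4" for u
  proof (rule real_le_lsqrt)
    have "(real n * exp (- ?l * u))\<^sup>2 = (real n)\<^sup>2 * exp (- 2 * u * ?l)"
      by (simp add: power_mult_distrib exp_double[symmetric] algebra_simps)
    then show "second_moment (1 - u) n \<le> (real n * exp (- ?l * u))\<^sup>2"
      using second_moment_le[OF that n] by simp
  qed simp
  show ?thesis
  proof (cases "cos t \<ge> 3 / 4")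
    case True
    then have "sqrt (second_moment (cos t) n) \<le> n * exp (- ?l * (1 - cos t))"
      using key[of "1 - cos t"] by simp
    also have "\<dots> \<le> n * (exp (- ?l * (1 - cos t)) + exp (- ?l / 4))"
      by (intro mult_left_mono) auto
    finally show ?thesis .
  next
    case False
    then have "sqrt (second_moment (cos t) n) \<le> sqrt (second_moment (1 - 1/4) n)"
      using second_moment_mono[of "cos t" "1 - 1/4" n] n by simp
    also have "\<dots> \<le> n * exp (- ?l * (1/4))" by (rule key) auto
    also have "\<dots> \<le> n * (exp (- ?l * (1 - cos t)) + exp (- ?l / 4))"
      by (intro mult_left_mono) auto
    finally show ?thesis .
  qed
qed

section \<open>Fourier coefficients and Gaussian integrals\<close>

lemma integral_cis_int:
  fixes j :: int
  shows "(LINT t:{-pi..pi}|lborel. cis (j * t)) = (if j = 0 then of_real (2 * pi) else 0)"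
proof (cases "j = 0")
  case True
  then show ?thesis by (simp add: set_lebesgue_integral_def scaleR_conv_of_real flip: cis_zero)
next
  case False
  define F where "F = (\<lambda>t::real. cis (j * t) / (\<i> * of_int j))"
  have "has_bochner_integral lborel (\<lambda>t. indicator {-pi..pi} t *\<^sub>R cis (j * t)) (F pi - F (-pi))"
  proof (rule has_bochner_integral_FTC_Icc)
    fix t :: real
    show "(F has_vector_derivative cis (j * t)) (at t within {-pi..pi})"
      unfolding F_def cis_conv_exp of_real_mult of_real_of_int_eq using False
      by (intro has_vector_derivative_real_field) (auto intro!: derivative_eq_intros simp: field_simps)
  qed (auto intro!: continuous_intros)
  moreover have "F pi = F (-pi)"
  proof -
    have "cis (j * pi) = cis (j * (- pi))"
      by (simp add: complex_eq_iff mult.commute[of _ pi])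
    then show ?thesis by (simp only: F_def)
  qed
  ultimately show ?thesis
    using False by (simp add: set_lebesgue_integral_def has_bochner_integral_integral_eq)
qed


lemma norm_fourier_coeff_le:
  fixes c :: "nat \<Rightarrow> complex"
  assumes c: "summable (\<lambda>k. norm (c k))"
    and f: "\<And>t. (\<lambda>k. c k * cis t ^ k) sums f t"
  shows "norm (c m) \<le> (LINT t:{-pi..pi}|lborel. norm (f t)) / (2 * pi)"
proof -
  define g where "g = (\<lambda>k t. indicator {-pi..pi} t *\<^sub>R (c k * cis t ^ k * cis (- (real m * t))))"
  have g_eq: "g k t = c k * (indicator {-pi..pi} t *\<^sub>R cis (of_int (int k - int m) * t))" for k t
    by (simp add: g_def Complex.DeMoivre cis_mult algebra_simps)
  have norm_g: "norm (g k t) = norm (c k) * indicator {-pi..pi} t" for k t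
    by (simp add: g_eq norm_mult)
  have int_g: "integrable lborel (g k)" for k
    unfolding g_def
    by (rule borel_integrable_atLeastAtMost'[unfolded set_integrable_def]) (auto intro!: continuous_intros)
  have summable_g: "summable (\<lambda>k. \<integral>t. norm (g k t) \<partial>lborel)"
    unfolding norm_g using c by (simp add: summable_mult2)
  have AE_g: "AE t in lborel. summable (\<lambda>k. norm (g k t))"
    unfolding norm_g using c by (simp add: summable_mult2)
  have integral_g: "(\<integral>t. g k t \<partial>lborel) = (if k = m then c m * (2 * pi) else 0)" for k
  proof -
    have "(\<integral>t. g k t \<partial>lborel) = c k * (LINT t:{-pi..pi}|lborel. cis (of_int (int k - int m) * t))"
      unfolding g_eq set_lebesgue_integral_def by (rule integral_mult_right_zero)
    then show ?thesis unfolding integral_cis_int by simp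
  qed
  have sum_g: "(\<Sum>k. g k t) = indicator {-pi..pi} t *\<^sub>R (f t * cis (- (real m * t)))" for t
    unfolding g_def
    by (rule sums_unique[symmetric], intro sums_scaleR_right sums_mult2 f)
  have "(\<lambda>k. if k = m then c m * (2 * pi) else 0) sums
    (\<integral>t. indicator {-pi..pi} t *\<^sub>R (f t * cis (- (real m * t))) \<partial>lborel)"
    using sums_integral[OF int_g AE_g summable_g] unfolding integral_g sum_g .
  then have "c m * (2 * pi) = (\<integral>t. indicator {-pi..pi} t *\<^sub>R (f t * cis (- (real m * t))) \<partial>lborel)"
    using sums_unique2[OF _ sums_single[of m "\<lambda>_. c m * (2 * pi)"]] by metis
  then have "norm (c m * (2 * pi)) \<le> (\<integral>t. norm (indicator {-pi..pi} t *\<^sub>R (f t * cis (- (real m * t)))) \<partial>lborel)"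
    by (simp only: integral_norm_bound)
  also have "\<dots> = (LINT t:{-pi..pi}|lborel. norm (f t))"
    by (simp add: set_lebesgue_integral_def norm_mult)
  finally show ?thesis by (simp add: norm_mult field_simps)
qed

section \<open>Gaussian domination and Laplace's method on the circle\<close>

lemma set_integral_le_integral:
  fixes f g :: "real \<Rightarrow> real"
  assumes "continuous_on {a..b} f" "has_bochner_integral lborel g I"
    and "\<And>t. t \<in> {a..b} \<Longrightarrow> f t \<le> g t" "\<And>t. 0 \<le> g t"
  shows "(LINT t:{a..b}|lborel. f t) \<le> I"
proof -
  have "(LINT t:{a..b}|lborel. f t) \<le> integral\<^sup>L lborel g"
    unfolding set_lebesgue_integral_def
    using borel_integrable_atLeastAtMost'[OF assms(1)] assms
    by (intro integral_mono) (auto simp: set_integrable_def has_bochner_integral_iff indicator_def)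
  then show ?thesis using assms(2) by (simp add: has_bochner_integral_iff)
qed

lemma one_minus_cos_ge:
  fixes t :: real
  shows "1 - cos t \<ge> t\<^sup>2 / 2 - t ^ 4 / 24"
proof -
  obtain s where "cos t = (\<Sum>m<4. cos_coeff m * t ^ m) + cos (s + 1 / 2 * real 4 * pi) / fact 4 * t ^ 4"
    using Maclaurin_cos_expansion[of t 4] by blast
  moreover have "cos (s + 1 / 2 * real 4 * pi) / fact 4 * t ^ 4 \<le> 1 / 24 * t ^ 4"
    by (intro mult_right_mono) (simp_all add: fact_numeral)
  moreover have "(\<Sum>m<4. cos_coeff m * t ^ m) = 1 - t\<^sup>2 / 2"
    by (simp add: lessThan_nat_numeral cos_coeff_def fact_numeral)
  ultimately show ?thesis by linarith
qed

text \<open>Since cos (pi/2) = 0, the quartic bound forces y/2 - y^2/24 \<le> 1 for y = (pi/2)^2,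
  which fails for y between 26/10 and 4. The bound lies below 21/2, as
  \<open>one_minus_cos_ge_quadratic\<close> requires.\<close>

lemma pi_squared_le: "pi\<^sup>2 \<le> 104 / 10"
proof (rule ccontr)
  define y where "y = (pi / 2)\<^sup>2"
  assume "\<not> ?thesis"
  then have y: "y > 26 / 10" by (simp add: y_def power_divide)
  have y4: "y < 4"
    using pi_half_less_two power_strict_mono[of "pi / 2" 2 2] by (simp add: y_def)
  have "y / 2 - y\<^sup>2 / 24 \<le> 1"
    using one_minus_cos_ge[of "pi / 2"] by (simp add: y_def power_mult[symmetric])
  moreover have "(y - 26 / 10) * (4 - y) > 0" using y y4 by simp
  then have "66 / 10 * y - 104 / 10 - y\<^sup>2 > 0" by (simp add: power2_eq_square field_simps)
  ultimately show False using y by linarith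
qed

text \<open>A weaker coefficient than 1/2 buys validity on the whole circle, so that error terms can
  be dominated by one Gaussian everywhere. The difference to the quartic bound is t^2 (7/16 -
  t^2/24).\<close>

lemma one_minus_cos_ge_quadratic:
  assumes "\<bar>t\<bar> \<le> pi"
  shows "1 - cos t \<ge> t\<^sup>2 / 16"
proof -
  have "t\<^sup>2 \<le> 104 / 10"
    using assms pi_squared_le by (meson abs_le_square_iff abs_ge_self order.trans power2_abs)
  then have "t\<^sup>2 * (7 / 16 - t\<^sup>2 / 24) \<ge> 0" by (intro mult_nonneg_nonneg) auto
  then have "t\<^sup>2 / 16 \<le> t\<^sup>2 / 2 - t ^ 4 / 24"
    by (simp add: algebra_simps power_add[symmetric])
  then show ?thesis using one_minus_cos_ge[of t] by linarith
qed

lemma gaussian_moment_even: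
  fixes \<sigma> :: real
  assumes "\<sigma> > 0"
  shows "has_bochner_integral lborel (\<lambda>x. exp (- x\<^sup>2 / (2 * \<sigma>\<^sup>2)) * x ^ (2 * k))
    (sqrt (2 * pi) * \<sigma> * (fact (2 * k) / ((2 / \<sigma>\<^sup>2) ^ k * fact k)))"
proof -
  have "sqrt (2 * pi * \<sigma>\<^sup>2) = sqrt (2 * pi) * \<sigma>"
    using assms by (simp add: real_sqrt_mult)
  then show ?thesis
    using has_bochner_integral_mult_right[of "sqrt (2 * pi) * \<sigma>", OF normal_moment_even[OF assms, of 0 k]] assms
    by (simp add: normal_density_def mult.assoc[symmetric])
qed

lemma gaussian_moment_abs_odd:
  fixes \<sigma> :: real
  assumes "\<sigma> > 0"
  shows "has_bochner_integral lborel (\<lambda>x. exp (- x\<^sup>2 / (2 * \<sigma>\<^sup>2)) * \<bar>x\<bar> ^ (2 * k + 1))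
    (2 * (2 ^ k * \<sigma> ^ (2 * k + 2) * fact k))"
proof -
  have s: "sqrt (2 * pi * \<sigma>\<^sup>2) = sqrt (2 * pi) * \<sigma>"
    using assms by (simp add: real_sqrt_mult)
  have "sqrt (2 * pi) * sqrt (2 / pi) = 2"
    by (simp add: real_sqrt_mult[symmetric])
  then have "sqrt (2 * pi) * \<sigma> * (2 ^ k * \<sigma> ^ (2 * k + 1) * fact k * sqrt (2 / pi)) =
    2 * (2 ^ k * \<sigma> ^ (2 * k + 2) * fact k)"
    by (simp add: algebra_simps)
  moreover have "(\<lambda>x. sqrt (2 * pi) * \<sigma> * (normal_density 0 \<sigma> x * \<bar>x - 0\<bar> ^ (2 * k + 1))) =
    (\<lambda>x. exp (- x\<^sup>2 / (2 * \<sigma>\<^sup>2)) * \<bar>x\<bar> ^ (2 * k + 1))"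
    unfolding normal_density_def s using assms by simp
  ultimately show ?thesis
    using has_bochner_integral_mult_right[of "sqrt (2 * pi) * \<sigma>", OF normal_moment_abs_odd[OF assms, of 0 k]]
    by (simp only:)
qed

text \<open>The integrand is dominated by exp (-l t^2/16), a Gaussian of variance 8/l, whose third
  absolute moment is known. This will measure the error in the mean level sizes.\<close>

lemma integral_abs_cube_le:
  assumes l: "l > 0"
  shows "(LINT t:{-pi..pi}|lborel. \<bar>t\<bar> ^ 3 * exp (- l * (1 - cos t))) \<le> 256 / l\<^sup>2"
proof (rule set_integral_le_integral)
  show "has_bochner_integral lborel (\<lambda>t. exp (- l * t\<^sup>2 / 16) * \<bar>t\<bar> ^ 3) (256 / l\<^sup>2)"
  proof -
    define s where "s = sqrt (8 / l)"
    have s: "s > 0" "s\<^sup>2 = 8 / l" using l by (simp_all add: s_def)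
    have "s ^ 4 = (s\<^sup>2)\<^sup>2" by (simp flip: power_mult)
    then have "2 * (2 ^ 1 * s ^ (2 * 1 + 2) * fact 1) = 256 / l\<^sup>2"
      by (simp add: s power_divide)
    moreover have "(\<lambda>t. exp (- t\<^sup>2 / (2 * s\<^sup>2)) * \<bar>t\<bar> ^ (2 * 1 + 1)) = (\<lambda>t. exp (- l * t\<^sup>2 / 16) * \<bar>t\<bar> ^ 3)"
      unfolding s(2) using l by (simp add: eval_nat_numeral mult_ac)
    ultimately show ?thesis
      using gaussian_moment_abs_odd[OF s(1), of 1] by (simp only:)
  qed
  fix t assume "t \<in> {-pi..pi}"
  then have "t\<^sup>2 / 16 \<le> 1 - cos t" by (intro one_minus_cos_ge_quadratic) auto
  then have "l * (t\<^sup>2 / 16) \<le> l * (1 - cos t)" using l by (intro mult_left_mono) auto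
  then show "\<bar>t\<bar> ^ 3 * exp (- l * (1 - cos t)) \<le> exp (- l * t\<^sup>2 / 16) * \<bar>t\<bar> ^ 3"
    by (simp add: mult.commute mult_left_mono)
qed (auto intro!: continuous_intros)

text \<open>Laplace's method with explicit error: the integrand exceeds exp (-l t^2/2) by at most l
  t^4/24 times the wider Gaussian exp (-l t^2/16), whose fourth moment makes this a relative error
  of order 1/l.\<close>

lemma integral_exp_cos_le:
  assumes l: "l > 0"
  shows "(LINT t:{-pi..pi}|lborel. exp (- l * (1 - cos t))) / (2 * pi) \<le>
    1 / sqrt (2 * pi * l) * (1 + 24 / l)"
proof -
  define s where "s = sqrt (8 / l)"
  have s: "s > 0" "s\<^sup>2 = 8 / l" using l by (simp_all add: s_def)
  have 1: "has_bochner_integral lborel (\<lambda>t. exp (- l * t\<^sup>2 / 2)) (sqrt (2 * pi) / sqrt l)"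
    using gaussian_moment_even[of "1 / sqrt l" 0] l by (simp add: power_divide mult_ac)
  have 2: "has_bochner_integral lborel (\<lambda>t. exp (- l * t\<^sup>2 / 16) * t ^ 4) (sqrt (2 * pi) * s * (192 / l\<^sup>2))"
  proof -
    have "fact (2 * 2) / ((2 / s\<^sup>2) ^ 2 * fact 2) = 192 / l\<^sup>2"
      unfolding s(2) using l by (simp add: power_divide fact_numeral power2_eq_square)
    moreover have "(\<lambda>t. exp (- t\<^sup>2 / (2 * s\<^sup>2)) * t ^ (2 * 2)) = (\<lambda>t. exp (- l * t\<^sup>2 / 16) * t ^ 4)"
      unfolding s(2) using l by (simp add: mult.commute)
    ultimately show ?thesis
      using gaussian_moment_even[OF s(1), of 2] by (simp only:)
  qed
  have "(LINT t:{-pi..pi}|lborel. exp (- l * (1 - cos t))) \<le>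
    sqrt (2 * pi) / sqrt l + l / 24 * (sqrt (2 * pi) * s * (192 / l\<^sup>2))"
  proof (rule set_integral_le_integral[OF _ has_bochner_integral_add[OF 1 has_bochner_integral_mult_right[OF 2]]])
    fix t assume t: "t \<in> {-pi..pi}"
    let ?A = "l * (t\<^sup>2 / 2 - (1 - cos t))"
    have "t\<^sup>2 / 16 \<le> 1 - cos t" using t by (intro one_minus_cos_ge_quadratic) auto
    then have le: "exp (- l * (1 - cos t)) \<le> exp (- l * t\<^sup>2 / 16)"
      using l mult_left_mono[of "t\<^sup>2 / 16" "1 - cos t" l] by simp
    have A: "?A \<le> l / 24 * t ^ 4"
      using l mult_left_mono[OF one_minus_cos_ge[of t], of l] by (simp add: algebra_simps)
    \<comment> \<open>The form exp A \<le> 1 + A exp A keeps exp A in the error term. There it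
      recombines with exp (-l t^2/2) to the original integrand, which the wide Gaussian
      dominates.\<close>
    have "exp ?A * (1 - ?A) \<le> 1"
      using mult_left_mono[OF exp_ge_add_one_self[of "- ?A"], of "exp ?A"] by (simp add: exp_add[symmetric])
    then have "exp (- l * t\<^sup>2 / 2) * exp ?A \<le> exp (- l * t\<^sup>2 / 2) * (1 + ?A * exp ?A)"
      by (intro mult_left_mono) (auto simp: algebra_simps)
    also have "\<dots> = exp (- l * t\<^sup>2 / 2) + ?A * (exp (- l * t\<^sup>2 / 2) * exp ?A)"
      by (simp add: algebra_simps)
    also have "exp (- l * t\<^sup>2 / 2) * exp ?A = exp (- l * (1 - cos t))"
      by (simp add: exp_add[symmetric] algebra_simps)
    finally have "exp (- l * (1 - cos t)) \<le> exp (- l * t\<^sup>2 / 2) + ?A * exp (- l * (1 - cos t))" .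
    also have "?A * exp (- l * (1 - cos t)) \<le> (l / 24 * t ^ 4) * exp (- l * (1 - cos t))"
      by (intro mult_right_mono A) auto
    also have "\<dots> \<le> (l / 24 * t ^ 4) * exp (- l * t\<^sup>2 / 16)"
      using l by (intro mult_left_mono le) auto
    finally show "exp (- l * (1 - cos t)) \<le> exp (- l * t\<^sup>2 / 2) + l / 24 * (exp (- l * t\<^sup>2 / 16) * t ^ 4)"
      by (simp add: mult_ac)
  qed (use l in \<open>auto intro!: continuous_intros\<close>)
  also have "l / 24 * (sqrt (2 * pi) * s * (192 / l\<^sup>2)) = 32 * sqrt pi / (l * sqrt l)"
  proof -
    have "sqrt (2 * pi) * s = sqrt (16 * pi / l)" unfolding s_def by (simp flip: real_sqrt_mult)
    also have "\<dots> = 4 * sqrt pi / sqrt l" by (simp add: real_sqrt_divide real_sqrt_mult)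
    finally have "sqrt (2 * pi) * s = 4 * sqrt pi / sqrt l" .
    then show ?thesis using l by (simp add: power2_eq_square)
  qed
  finally have "(LINT t:{-pi..pi}|lborel. exp (- l * (1 - cos t))) / (2 * pi) \<le>
    (sqrt (2 * pi) / sqrt l + 32 * sqrt pi / (l * sqrt l)) / (2 * pi)"
    by (intro divide_right_mono) auto
  also have "\<dots> = 1 / sqrt (2 * pi * l) * (1 + 16 * sqrt 2 / l)"
  proof -
    have 1: "1 / sqrt (2 * pi * l) = sqrt (2 * pi) / (2 * pi) / sqrt l"
      using sqrt_divide_self_eq[of "2 * pi"] by (simp add: real_sqrt_mult[of _ l] divide_simps)
    have 2: "32 * sqrt pi = sqrt (2 * pi) * (16 * sqrt 2)"
      by (simp add: real_sqrt_mult)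
    have "(A / B + A * C / (l * B)) / D = A / D / B * (1 + C / l)"
      if "B \<noteq> 0" "D \<noteq> 0" for A B C D :: real
      using l that by (simp add: field_simps)
    then show ?thesis unfolding 1 2 using l by simp
  qed
  also have "\<dots> \<le> 1 / sqrt (2 * pi * l) * (1 + 24 / l)"
  proof -
    have "sqrt 2 \<le> 3 / 2" by (rule real_le_lsqrt) (simp_all add: power2_eq_square)
    then show ?thesis using l by (intro mult_left_mono add_left_mono divide_right_mono) auto
  qed
  finally show ?thesis .
qed

section \<open>The upper bound for the expected width\<close>

lemma width_le_integral:
  "real (MAX k. level_size n p k) \<le>
    (LINT t:{-pi..pi}|lborel. cmod (level_poly n p (cis t))) / (2 * pi)"
proof -
  \<comment> \<open>The maximum is attained at some level m, and the Fourier bound for the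
    coefficient at m does not depend on m.\<close>
  have "(MAX k. level_size n p k) \<in> range (level_size n p)"
    by (intro Max_in finite_range_level_size) auto
  then obtain m where m: "(MAX k. level_size n p k) = level_size n p m" by auto
  have fin: "level_size n p k = 0" if "k \<notin> {..n}" for k
    using that by (simp add: level_size_eq_0)
  have "norm (complex_of_nat (level_size n p m)) \<le>
    (LINT t:{-pi..pi}|lborel. cmod (level_poly n p (cis t))) / (2 * pi)"
  proof (rule norm_fourier_coeff_le[of "\<lambda>k. complex_of_nat (level_size n p k)"])
    show "summable (\<lambda>k. norm (complex_of_nat (level_size n p k)))"
      using fin by (intro summable_finite[of "{..n}"]) auto
    show "(\<lambda>k. complex_of_nat (level_size n p k) * cis t ^ k) sums level_poly n p (cis t)" for t
      unfolding level_poly_eq_sum_level_size using fin by (intro sums_finite) auto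
  qed
  then show ?thesis by (simp add: m)
qed

text \<open>Cauchy-Schwarz over the (n - 1)! attachments.\<close>

lemma mean_cmod_level_poly_le:
  assumes "n \<ge> 1"
  shows "(\<Sum>p\<in>attachments n. cmod (level_poly n p (cis t))) / fact (n - 1) \<le> sqrt (second_moment (cos t) n)"
proof (rule real_le_rsqrt)
  have "((\<Sum>p\<in>attachments n. cmod (level_poly n p (cis t))) / fact (n - 1))\<^sup>2 \<le>
    ((\<Sum>p\<in>attachments n. (cmod (level_poly n p (cis t)))\<^sup>2) * fact (n - 1)) / (fact (n - 1))\<^sup>2"
    unfolding power_divide
    using sum_squared_le_sum_of_squares[of "\<lambda>p. cmod (level_poly n p (cis t))" "attachments n"]
      card_attachments[OF assms]
    by (intro divide_right_mono) auto
  also have "\<dots> = second_moment (cos t) n"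
    unfolding sum_cmod_level_poly[OF assms, symmetric] by (simp add: power2_eq_square)
  finally show "((\<Sum>p\<in>attachments n. cmod (level_poly n p (cis t))) / fact (n - 1))\<^sup>2 \<le> second_moment (cos t) n" .
qed

lemma continuous_on_cmod_level_poly [continuous_intros]:
  "continuous_on A (\<lambda>t. cmod (level_poly n p (cis t)))"
  unfolding level_poly_def by (intro continuous_intros)

text \<open>The integral bound holds tree by tree. Exchanging the finite mean with the integral
  leaves the mean modulus at a fixed t, which the second moment controls.\<close>

lemma expected_width_upper:
  assumes n: "n \<ge> 1" and l: "l = ln n - 5 / 2" "l > 0"
  shows "expected_width n \<le> n * (1 / sqrt (2 * pi * l) * (1 + 24 / l) + exp (- l / 4))"
proof -
  let ?F = "\<lambda>p t. cmod (level_poly n p (cis t))"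
  have int: "set_integrable lborel {-pi..pi} (?F p)" for p
    by (intro borel_integrable_atLeastAtMost' continuous_intros)
  have "expected_width n \<le>
    (\<Sum>p\<in>attachments n. (LINT t:{-pi..pi}|lborel. ?F p t) / (2 * pi)) / fact (n - 1)"
    unfolding expected_width_attachments[OF n]
    by (intro divide_right_mono sum_mono width_le_integral) auto
  also have "\<dots> = (LINT t:{-pi..pi}|lborel. (\<Sum>p\<in>attachments n. ?F p t) / fact (n - 1)) / (2 * pi)"
  proof -
    have "(LINT t:{-pi..pi}|lborel. \<Sum>p\<in>attachments n. ?F p t) =
      (\<Sum>p\<in>attachments n. LINT t:{-pi..pi}|lborel. ?F p t)"
      using int unfolding set_lebesgue_integral_def set_integrable_def scaleR_sum_right
      by (intro Bochner_Integration.integral_sum)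
    then show ?thesis by (simp add: sum_divide_distrib[symmetric])
  qed
  also have "\<dots> \<le> (LINT t:{-pi..pi}|lborel. n * (exp (- l * (1 - cos t)) + exp (- l / 4))) / (2 * pi)"
  proof (intro divide_right_mono set_integral_mono)
    fix t
    show "(\<Sum>p\<in>attachments n. ?F p t) / fact (n - 1) \<le> n * (exp (- l * (1 - cos t)) + exp (- l / 4))"
      using mean_cmod_level_poly_le[OF n, of t] sqrt_second_moment_le[OF n, of t] unfolding l(1) by linarith
  qed (auto intro!: borel_integrable_atLeastAtMost' continuous_intros)
  also have "(LINT t:{-pi..pi}|lborel. n * (exp (- l * (1 - cos t)) + exp (- l / 4))) =
    n * ((LINT t:{-pi..pi}|lborel. exp (- l * (1 - cos t))) + 2 * pi * exp (- l / 4))"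
  proof -
    have "set_integrable lborel {-pi..pi} (\<lambda>t. exp (- l * (1 - cos t)))"
      "set_integrable lborel {-pi..pi} (\<lambda>t. exp (- l / 4))"
      by (intro borel_integrable_atLeastAtMost' continuous_intros)+
    then show ?thesis by (simp add: set_integral_add) (simp add: set_lebesgue_integral_def)
  qed
  also have "\<dots> / (2 * pi) = n * ((LINT t:{-pi..pi}|lborel. exp (- l * (1 - cos t))) / (2 * pi) + exp (- l / 4))"
    by (simp add: field_simps)
  also have "\<dots> \<le> n * (1 / sqrt (2 * pi * l) * (1 + 24 / l) + exp (- l / 4))"
    using integral_exp_cos_le[OF l(2)] by (intro mult_left_mono) auto
  finally show ?thesis .
qed

section \<open>Stirling's bound and Poisson weights\<close>

text \<open>With factorials in place of the partial Wallis product, its logarithm can be expressed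
  by \<open>stirling_defect\<close>.\<close>

lemma wallis_prod_eq:
  "(\<Prod>k=1..n. (4 * real k ^ 2) / (4 * real k ^ 2 - 1)) =
    16 ^ n * fact n ^ 4 / ((fact (2 * n))\<^sup>2 * (2 * n + 1))"
proof (induction n)
  case (Suc n)
  have f: "fact (2 * Suc n) = (2 * real n + 2) * (2 * real n + 1) * fact (2 * n)"
    "fact (Suc n) = (real n + 1) * fact n"
    by (simp_all add: algebra_simps)
  have step: "4 * (a + 1)\<^sup>2 / (4 * (a + 1)\<^sup>2 - 1) * (16 ^ n * F ^ 4 / (G\<^sup>2 * (2 * a + 1))) =
    16 ^ Suc n * ((a + 1) * F) ^ 4 / (((2 * a + 2) * (2 * a + 1) * G)\<^sup>2 * (2 * (a + 1) + 1))"
    if "a \<ge> 0" "F > 0" "G > 0" for a F G :: real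
  proof -
    have eqs: "4 * (a + 1)\<^sup>2 - 1 = (2 * a + 1) * (2 * a + 3)" "2 * a + 2 = 2 * (a + 1)" "2 * (a + 1) + 1 = 2 * a + 3"
      by (simp_all add: power2_eq_square algebra_simps)
    define x y where "x = 2 * a + 1" and "y = a + 1"
    have "x \<noteq> 0" "y \<noteq> 0" "2 * a + 3 \<noteq> 0" using that by (simp_all add: x_def y_def)
    then show ?thesis
      unfolding eqs unfolding x_def[symmetric] y_def[symmetric] using that
      by (simp add: divide_simps) (simp add: power2_eq_square power4_eq_xxxx)
  qed
  have "(\<Prod>k=1..Suc n. (4 * real k ^ 2) / (4 * real k ^ 2 - 1)) =
    4 * (real n + 1)\<^sup>2 / (4 * (real n + 1)\<^sup>2 - 1) * (16 ^ n * fact n ^ 4 / ((fact (2 * n))\<^sup>2 * (2 * real n + 1)))"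
    using Suc by (simp add: add.commute mult.commute)
  also have "\<dots> = 16 ^ Suc n * fact (Suc n) ^ 4 / ((fact (2 * Suc n))\<^sup>2 * (2 * real (Suc n) + 1))"
    unfolding f by (subst step) (auto simp: add.commute)
  finally show ?case .
qed simp

text \<open>The logarithm of n! / (n^(n + 1/2) e^(-n)), whose limit is ln (2 pi) / 2.\<close>

definition stirling_defect :: "nat \<Rightarrow> real" where
  "stirling_defect n = ln (fact n) - (n + 1 / 2) * ln n + n"

text \<open>The difference is (n + 1/2) (ln (n + 1) - ln n) - 1. The integral of 1/x over [n, n + 1]
  lies between its midpoint and trapezoid values: the former gives 0, the latter a telescoping
  excess.\<close>

lemma stirling_defect_diff:
  assumes "n \<ge> 1"
  shows "0 \<le> stirling_defect n - stirling_defect (Suc n)"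
    and "stirling_defect n - stirling_defect (Suc n) \<le> 1 / (4 * real n) - 1 / (4 * real (Suc n))"
proof -
  have "ln (fact (Suc n) :: real) = ln (real n + 1) + ln (fact n)"
    by (simp add: ln_mult add.commute)
  then have eq: "stirling_defect n - stirling_defect (Suc n) = (n + 1 / 2) * (ln (real n + 1) - ln n) - 1"
    by (simp add: stirling_defect_def algebra_simps)
  have "2 / (2 * real n + 1) \<le> ln (real n + 1) - ln n"
    using ln_inverse_approx_ge[of "real n" "real n + 1"] assms by simp
  then have le: "(n + 1 / 2) * (2 / (2 * real n + 1)) \<le> (n + 1 / 2) * (ln (real n + 1) - ln n)"
    by (intro mult_left_mono) auto
  have "1 = (n + 1 / 2) * (2 / (2 * real n + 1))" by (simp add: field_simps)
  also note le
  finally show "0 \<le> stirling_defect n - stirling_defect (Suc n)" unfolding eq by simp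
  have "ln (real n + 1) - ln n \<le> (1 / real n + 1 / (real n + 1)) / 2"
    using ln_inverse_approx_le[of "real n" 1] assms by (simp add: inverse_eq_divide)
  then have "(n + 1 / 2) * (ln (real n + 1) - ln n) \<le> (n + 1 / 2) * ((1 / real n + 1 / (real n + 1)) / 2)"
    by (intro mult_left_mono) auto
  moreover have "(n + 1 / 2) * ((1 / real n + 1 / (real n + 1)) / 2) - 1 = 1 / (4 * real n) - 1 / (4 * real (Suc n))"
    using assms by (simp add: divide_simps) (simp add: algebra_simps)
  ultimately show "stirling_defect n - stirling_defect (Suc n) \<le> 1 / (4 * real n) - 1 / (4 * real (Suc n))"
    unfolding eq by linarith
qed

text \<open>Once the defect is known to converge to some D, the left side tends to 2D, while Wallis'
  product gives the limit of the right side. So this identity determines D.\<close>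

lemma stirling_defect_double:
  assumes "n \<ge> 1"
  shows "2 * (2 * stirling_defect n - stirling_defect (2 * n)) =
    ln (\<Prod>k=1..n. (4 * real k ^ 2) / (4 * real k ^ 2 - 1)) + ln ((2 * real n + 1) * 2 / n)"
proof -
  have "ln (16 ^ n * fact n ^ 4 / ((fact (2 * n))\<^sup>2 * (2 * real n + 1))) =
    n * ln 16 + 4 * ln (fact n) - 2 * ln (fact (2 * n)) - ln (2 * real n + 1)"
    by (simp add: ln_mult ln_div ln_realpow)
  moreover have "ln 16 = 4 * ln (2::real)" using ln_realpow[of 2 4] by simp
  moreover have "ln (2 * real n) = ln 2 + ln n" using assms by (simp add: ln_mult)
  moreover have "ln ((2 * real n + 1) * 2 / n) = ln (2 * real n + 1) + ln 2 - ln n"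
    using assms ln_mult[of "2 * real n + 1" 2] by (simp add: ln_div)
  ultimately show ?thesis
    unfolding wallis_prod_eq stirling_defect_def by (simp add: algebra_simps)
qed

text \<open>The defect decreases and the defect minus 1/(4n) increases, so they share a limit D and
  the latter stays below D. Wallis gives 2D = ln (pi/2) + ln 4 = ln (2 pi).\<close>

lemma ln_fact_le:
  assumes "n \<ge> 1"
  shows "ln (fact n) \<le> (n + 1 / 2) * ln n - n + ln (2 * pi) / 2 + 1 / (4 * n)"
proof -
  \<comment> \<open>The shift starts the sequences at n = 1, where the monotonicity bounds begin to
    hold.\<close>
  let ?d = "\<lambda>n. stirling_defect (Suc n)"
  let ?e = "\<lambda>n. stirling_defect (Suc n) - 1 / (4 * Suc n)"
  have dec: "decseq ?d"
    using stirling_defect_diff(1) by (intro decseq_SucI) (simp add: le_diff_eq)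
  have inc: "incseq ?e"
  proof (rule incseq_SucI)
    fix n show "?e n \<le> ?e (Suc n)"
      using stirling_defect_diff(2)[of "Suc n"] by simp
  qed
  have "?e 0 \<le> ?d n" for n
    using incseqD[OF inc, of 0 n] by (rule order.trans) simp_all
  then obtain D where D: "?d \<longlonglongrightarrow> D"
    using decseq_convergent[OF dec, of "?e 0"] by blast
  have "(\<lambda>n. 1 / (4 * real (Suc n))) \<longlonglongrightarrow> 0" by real_asymp
  from tendsto_diff[OF D this] have eD: "?e \<longlonglongrightarrow> D" by simp
  have lim: "stirling_defect \<longlonglongrightarrow> D" using D by (simp add: filterlim_sequentially_Suc)
  have lim2: "(\<lambda>n. stirling_defect (2 * n)) \<longlonglongrightarrow> D"
    by (rule filterlim_compose[OF lim]) (rule filterlim_subseq, simp add: strict_mono_def)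
  have "(\<lambda>n. 2 * (2 * stirling_defect n - stirling_defect (2 * n))) \<longlonglongrightarrow> 2 * (2 * D - D)"
    by (intro tendsto_intros lim lim2)
  moreover have "(\<lambda>n. 2 * (2 * stirling_defect n - stirling_defect (2 * n))) \<longlonglongrightarrow> ln (pi / 2) + ln 4"
  proof (rule Lim_transform_eventually)
    have "(\<lambda>n. ln ((2 * real n + 1) * 2 / n)) \<longlonglongrightarrow> ln 4" by real_asymp
    then show "(\<lambda>n. ln (\<Prod>k=1..n. (4 * real k ^ 2) / (4 * real k ^ 2 - 1)) + ln ((2 * real n + 1) * 2 / n))
      \<longlonglongrightarrow> ln (pi / 2) + ln 4"
      by (intro tendsto_add[OF tendsto_ln[OF wallis]]) auto
    show "\<forall>\<^sub>F n in sequentially. ln (\<Prod>k=1..n. (4 * real k ^ 2) / (4 * real k ^ 2 - 1)) + ln ((2 * real n + 1) * 2 / n)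
      = 2 * (2 * stirling_defect n - stirling_defect (2 * n))"
      using eventually_ge_at_top[of 1] by eventually_elim (rule stirling_defect_double[symmetric])
  qed
  ultimately have "2 * (2 * D - D) = ln (pi / 2) + ln 4" by (rule LIMSEQ_unique)
  also have "\<dots> = ln (2 * pi)" using ln_realpow[of 2 2] by (simp add: ln_mult ln_div)
  finally have "D = ln (2 * pi) / 2" by simp
  moreover have "?e (n - 1) \<le> D" using inc eD by (rule incseq_le)
  ultimately show ?thesis using assms by (simp add: stirling_defect_def)
qed

section \<open>Poisson weights near their mean and their generating functions\<close>

definition poisson :: "real \<Rightarrow> nat \<Rightarrow> real" where
  "poisson l k = exp (- l) * l ^ k / fact k"

text \<open>Write l = k + d. Rounding l down costs nothing, because (k + 1/2) (ln l - ln k) \<ge> d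
  by the midpoint bound for the logarithm. The only loss is Stirling's 1/(4k) \<le> 1/(4(l -
  1)).\<close>

lemma poisson_floor_ge:
  assumes l: "l > 1" and k: "k = nat \<lfloor>l\<rfloor>"
  shows "poisson l k \<ge> (1 - 1 / (4 * (l - 1))) / sqrt (2 * pi * l)"
proof -
  define d where "d = l - k"
  have k': "k \<le> l" "l < k + 1" "k \<ge> 1" using l k by linarith+
  then have d: "0 \<le> d" "d \<le> 1" by (simp_all add: d_def)
  have "ln l - ln k \<ge> 2 * d / (l + k)"
    using ln_inverse_approx_ge[of k l] k' by (cases "real k = l") (auto simp: d_def add.commute)
  then have "(k + 1 / 2) * (ln l - ln k) \<ge> (k + 1 / 2) * (2 * d / (l + k))"
    by (intro mult_left_mono) auto
  moreover have "(k + 1 / 2) * (2 * d / (l + k)) - d = d * (1 - d) / (l + k)"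
    using k' by (simp add: d_def field_simps)
  moreover have "d * (1 - d) / (l + k) \<ge> 0" using d k' by simp
  ultimately have 1: "(k + 1 / 2) * (ln l - ln k) \<ge> d" by linarith
  have "1 / (4 * real k) \<le> 1 / (4 * (l - 1))"
    using k' l by (intro divide_left_mono) auto
  moreover have "ln (2 * pi * l) = ln (2 * pi) + ln l" using l by (simp add: ln_mult)
  moreover have "(k + 1 / 2) * (ln l - ln k) = k * ln l + ln l / 2 - (k + 1 / 2) * ln k"
    by (simp add: algebra_simps)
  ultimately have "- 1 / (4 * (l - 1)) - ln (2 * pi * l) / 2 \<le> - l + k * ln l - ln (fact k)"
    using ln_fact_le[OF k'(3)] 1 unfolding d_def minus_divide_left[symmetric] by linarith
  then have "exp (- 1 / (4 * (l - 1)) - ln (2 * pi * l) / 2) \<le> exp (- l + k * ln l - ln (fact k))"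
    by (simp only: exp_le_cancel_iff)
  also have "\<dots> = poisson l k"
    using l by (simp add: poisson_def exp_add exp_diff exp_of_nat_mult exp_minus field_simps)
  also have "exp (- 1 / (4 * (l - 1)) - ln (2 * pi * l) / 2) = exp (- 1 / (4 * (l - 1))) / sqrt (2 * pi * l)"
  proof -
    have "exp (ln (2 * pi * l) / 2) = sqrt (2 * pi * l)"
      using l by (simp add: ln_sqrt[symmetric])
    then show ?thesis by (simp add: exp_diff)
  qed
  finally have "exp (- 1 / (4 * (l - 1))) / sqrt (2 * pi * l) \<le> poisson l k" .
  moreover have "(1 - 1 / (4 * (l - 1))) / sqrt (2 * pi * l) \<le> exp (- 1 / (4 * (l - 1))) / sqrt (2 * pi * l)"
    using l exp_ge_add_one_self[of "- 1 / (4 * (l - 1))"] by (intro divide_right_mono) auto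
  ultimately show ?thesis by linarith
qed

lemma poisson_sums:
  fixes z :: complex and l :: real
  shows "(\<lambda>k. of_real (poisson l k) * z ^ k) sums exp (l * (z - 1))"
proof -
  have "(\<lambda>k. of_real (exp (- l)) * ((l * z) ^ k /\<^sub>R fact k)) sums (of_real (exp (- l)) * exp (l * z))"
    by (intro sums_mult exp_converges)
  moreover have "of_real (exp (- l)) * exp (l * z) = exp (l * (z - 1))"
    by (simp add: exp_add[symmetric] algebra_simps flip: exp_of_real)
  ultimately show ?thesis
    by (simp add: poisson_def scaleR_conv_of_real power_mult_distrib field_simps)
qed

lemma poisson_Suc: "real (Suc k) * poisson l (Suc k) = l * poisson l k"
  by (simp add: poisson_def divide_simps)

text \<open>The factor (z - 1)^2 takes the second difference p(k) - 2 p(k-1) + p(k-2) of the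
  weights. With p(k-1) = (k/l) p(k) this is p(k) (l^2 - 2kl + k(k - 1))/l^2; the factors k and k(k -
  1) arise by shifting the series.\<close>

lemma poisson_sums_second_difference:
  fixes z :: complex and l :: real
  assumes l: "l > 0"
  shows "(\<lambda>k. of_real (poisson l k * ((k - l)\<^sup>2 - k) / l\<^sup>2) * z ^ k) sums ((z - 1)\<^sup>2 * exp (l * (z - 1)))"
proof -
  let ?E = "exp (l * (z - 1))"
  let ?p = "\<lambda>k. complex_of_real (poisson l k)"
  have p_Suc: "of_nat (Suc k) * ?p (Suc k) = l * ?p k" for k
    using poisson_Suc[of k l] by (metis of_real_mult of_real_of_nat_eq)
  have 1: "(\<lambda>k. of_nat k * ?p k * z ^ k) sums (l * z * ?E)"
  proof -
    have "(\<lambda>k. l * z * (?p k * z ^ k)) sums (l * z * ?E)" by (intro sums_mult poisson_sums)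
    moreover have "of_nat (Suc k) * ?p (Suc k) * z ^ Suc k = l * z * (?p k * z ^ k)" for k
      unfolding p_Suc by simp
    ultimately have "(\<lambda>k. of_nat (Suc k) * ?p (Suc k) * z ^ Suc k) sums (l * z * ?E)" by (simp only:)
    from sums_Suc_iff[where f = "\<lambda>k. of_nat k * ?p k * z ^ k", THEN iffD1, OF this]
    show ?thesis by simp
  qed
  have 2: "(\<lambda>k. of_nat k * (of_nat k - 1) * ?p k * z ^ k) sums (l * z * (l * z * ?E))"
  proof -
    have "(\<lambda>k. l * z * (of_nat k * ?p k * z ^ k)) sums (l * z * (l * z * ?E))" by (intro sums_mult 1)
    moreover have "of_nat (Suc k) * (of_nat (Suc k) - 1) * ?p (Suc k) * z ^ Suc k = l * z * (of_nat k * ?p k * z ^ k)" for k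
    proof -
      have "of_nat (Suc k) * (of_nat (Suc k) - 1) * ?p (Suc k) * z ^ Suc k =
        (of_nat (Suc k) * ?p (Suc k)) * (of_nat k * z ^ Suc k)" by simp
      then show ?thesis unfolding p_Suc by simp
    qed
    ultimately have "(\<lambda>k. of_nat (Suc k) * (of_nat (Suc k) - 1) * ?p (Suc k) * z ^ Suc k) sums (l * z * (l * z * ?E))"
      by (simp only:)
    from sums_Suc_iff[where f = "\<lambda>k. of_nat k * (of_nat k - 1) * ?p k * z ^ k", THEN iffD1, OF this]
    show ?thesis by simp
  qed
  have "(\<lambda>k. (of_nat k * (of_nat k - 1) * ?p k * z ^ k - 2 * l * (of_nat k * ?p k * z ^ k) + l\<^sup>2 * (?p k * z ^ k)) / l\<^sup>2)
    sums ((l * z * (l * z * ?E) - 2 * l * (l * z * ?E) + l\<^sup>2 * ?E) / l\<^sup>2)"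
    by (intro sums_divide sums_add sums_diff sums_mult 1 2 poisson_sums)
  moreover have "(l * z * (l * z * ?E) - 2 * l * (l * z * ?E) + l\<^sup>2 * ?E) / l\<^sup>2 = (z - 1)\<^sup>2 * ?E"
    using l by (simp add: field_simps power2_eq_square)
  moreover have "(of_nat k * (of_nat k - 1) * ?p k * z ^ k - 2 * l * (of_nat k * ?p k * z ^ k) + l\<^sup>2 * (?p k * z ^ k)) / l\<^sup>2 =
    of_real (poisson l k * ((k - l)\<^sup>2 - k) / l\<^sup>2) * z ^ k" for k
    by (simp add: algebra_simps power2_eq_square)
  ultimately show ?thesis by (simp only:)
qed

section \<open>The mean level sizes\<close>

text \<open>The linear terms of 1 + x and exp (-x) cancel, so each factor is 1 up to second order.
  This is what makes the product below bounded uniformly in n.\<close>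

lemma exp_factor_expansion:
  fixes x :: complex
  assumes x: "norm x \<le> 1"
  shows "norm ((1 + x) * exp (- x) - (1 - x\<^sup>2 / 2)) \<le> 4 * norm x ^ 3"
    and "norm ((1 + x) * exp (- x) - 1) \<le> 5 * (norm x)\<^sup>2"
proof -
  define r where "r = exp (- x) - (1 - x + x\<^sup>2 / 2)"
  have "norm r \<le> exp \<bar>Re (- x)\<bar> * norm (- x) ^ Suc 2 / fact 2"
    using Taylor_exp[of "- x" 2] by (simp add: r_def eval_nat_numeral)
  also have "\<dots> \<le> 3 * norm (- x) ^ Suc 2 / fact 2"
  proof (intro divide_right_mono mult_right_mono)
    have "exp \<bar>Re (- x)\<bar> \<le> exp 1" using abs_Re_le_cmod[of x] x by simp
    then show "exp \<bar>Re (- x)\<bar> \<le> 3" using exp_le by linarith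
  qed auto
  finally have r: "norm r \<le> 3 / 2 * norm x ^ 3" by (simp add: eval_nat_numeral)
  \<comment> \<open>Here (1 + x)(1 - x + x^2/2) = 1 - x^2/2 + x^3/2.\<close>
  have "(1 + x) * exp (- x) - (1 - x\<^sup>2 / 2) = x ^ 3 / 2 + (1 + x) * r"
    by (simp add: r_def field_simps power2_eq_square power3_eq_cube)
  also have "norm \<dots> \<le> norm x ^ 3 / 2 + 2 * (3 / 2 * norm x ^ 3)"
  proof (rule norm_triangle_mono)
    have "norm (1 + x) \<le> 2" using norm_triangle_ineq[of 1 x] x by simp
    then show "norm ((1 + x) * r) \<le> 2 * (3 / 2 * norm x ^ 3)"
      unfolding norm_mult using r by (intro mult_mono) auto
  qed (simp add: norm_divide norm_power)
  also have "\<dots> \<le> 4 * norm x ^ 3"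
    using zero_le_power[OF norm_ge_zero[of x], of 3] by linarith
  finally show *: "norm ((1 + x) * exp (- x) - (1 - x\<^sup>2 / 2)) \<le> 4 * norm x ^ 3" .
  have "norm x ^ 3 \<le> (norm x)\<^sup>2"
    using x by (intro power_decreasing) auto
  moreover have "norm ((1 + x) * exp (- x) - 1) \<le> norm ((1 + x) * exp (- x) - (1 - x\<^sup>2 / 2)) + norm (x\<^sup>2 / 2)"
    using norm_triangle_ineq4[of "(1 + x) * exp (- x) - (1 - x\<^sup>2 / 2)" "x\<^sup>2 / 2"] by simp
  moreover have "norm (x\<^sup>2 / 2) = (norm x)\<^sup>2 / 2" by (simp add: norm_divide norm_power)
  ultimately show "norm ((1 + x) * exp (- x) - 1) \<le> 5 * (norm x)\<^sup>2"
    using * zero_le_power2[of "norm x"] by linarith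
qed

lemma sum_inverse_squares_le: 
  assumes "n \<ge> 1"
  shows "(\<Sum>j=2..n. 1 / (real j)\<^sup>2) \<le> 1 - 1 / n"
  using assms
proof (induction n rule: dec_induct)
  case (step n)
  have "1 / (real (Suc n))\<^sup>2 \<le> 1 / n - 1 / Suc n"
    using step.hyps by (simp add: divide_simps power2_eq_square)
  then show ?case using step by simp
qed simp

text \<open>A partial Weierstrass product of the reciprocal gamma function, starting at j = 2. The
  factors exp (-w/j) strip off the growth e^(lw) of the mean level polynomial.\<close>

definition weierstrass_prod :: "nat \<Rightarrow> complex \<Rightarrow> complex" where
  "weierstrass_prod n w = (\<Prod>j=2..n. (1 + w / of_nat j) * exp (- (w / of_nat j)))"

text \<open>The radius 2 covers w = z - 1 on the unit circle, and j \<ge> 2 then keeps |w/j| \<le>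
  1. The factors deviate from 1 by at most 5 |w|^2/j^2, and the 1/j^2 sum to less than 1; the 20 is
  5 times 2^2.\<close>

lemma weierstrass_prod_minus_1:
  assumes w: "norm w \<le> 2" and n: "n \<ge> 1"
  shows "norm (weierstrass_prod n w - 1) \<le> 5 * exp 20 * (norm w)\<^sup>2" (is ?A)
    and "norm (weierstrass_prod n w) \<le> exp 20" (is ?B)
proof -
  let ?f = "\<lambda>j::nat. (1 + w / j) * exp (- (w / j)) - 1"
  define y where "y = 5 * (norm w)\<^sup>2"
  have y: "0 \<le> y" "y \<le> 20" using w power_mono[of "norm w" 2 2] by (simp_all add: y_def)
  have f: "norm (?f j) \<le> y * (1 / (real j)\<^sup>2)" if "j \<in> {2..n}" for j
  proof -
    have "norm (w / j) \<le> 1" using w that by (simp add: norm_divide divide_le_eq)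
    from exp_factor_expansion(2)[OF this] show ?thesis
      by (simp add: y_def norm_divide power_divide)
  qed
  have "(\<Sum>j=2..n. norm (?f j)) \<le> y * (\<Sum>j=2..n. 1 / (real j)\<^sup>2)"
    unfolding sum_distrib_left using f by (intro sum_mono)
  also have "\<dots> \<le> y * 1"
    using sum_inverse_squares_le[OF n] y by (intro mult_left_mono) (auto intro: order.trans)
  finally have s: "(\<Sum>j=2..n. norm (?f j)) \<le> y" by simp
  have "norm (weierstrass_prod n w - 1) \<le> (\<Prod>j=2..n. 1 + norm (?f j)) - 1"
    using norm_prod_minus1_le_prod_minus1[of ?f "{2..n}"] by (simp add: weierstrass_prod_def)
  also have "(\<Prod>j=2..n. 1 + norm (?f j)) \<le> exp (\<Sum>j=2..n. norm (?f j))"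
    by (rule prod_le_exp_sum) auto
  also have "\<dots> \<le> exp y" using s by simp
  finally have le: "norm (weierstrass_prod n w - 1) \<le> exp y - 1" by simp
  have "exp y * (1 - y) \<le> 1"
    using mult_left_mono[OF exp_ge_add_one_self[of "- y"], of "exp y"] by (simp add: exp_add[symmetric])
  then have "exp y - 1 \<le> y * exp y" by (simp add: algebra_simps)
  also have "\<dots> \<le> y * exp 20" using y by (intro mult_left_mono) auto
  finally show ?A using le by (simp add: y_def mult_ac)
  have "norm (weierstrass_prod n w) \<le> norm (weierstrass_prod n w - 1) + 1"
    using norm_triangle_ineq[of "weierstrass_prod n w - 1" 1] by simp
  also have "\<dots> \<le> exp y" using le by simp
  also have "\<dots> \<le> exp 20" using y by simp
  finally show ?B .
qed

text \<open>With G the product so far and 1 - x^2/2 + \<rho> the next factor, the error grows by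
  -(x^2/2)(G - 1) + G \<rho>. Both parts are of order |w|^3/j^2, with constants 5 and 4 times exp
  20, hence summable over j.\<close>

lemma weierstrass_prod_expansion:
  fixes w :: complex
  assumes w: "norm w \<le> 2" and n: "n \<ge> 1"
  shows "norm (weierstrass_prod n w - (1 - (\<Sum>j=2..n. 1 / (real j)\<^sup>2) / 2 * w\<^sup>2)) \<le> 9 * exp 20 * norm w ^ 3"
proof -
  let ?s = "\<lambda>n. \<Sum>j=2..n. 1 / (real j)\<^sup>2"
  let ?R = "\<lambda>n. weierstrass_prod n w - (1 - ?s n / 2 * w\<^sup>2)"
  \<comment> \<open>The factor \<open>?s n\<close> lets the bound grow along with the accumulated
    errors; at the end it is replaced by 1.\<close>
  have "norm (?R n) \<le> 9 * exp 20 * norm w ^ 3 * ?s n"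
    using n
  proof (induction n rule: dec_induct)
    case base
    then show ?case by (simp add: weierstrass_prod_def)
  next
    case (step n)
    define x where "x = w / Suc n"
    define G where "G = weierstrass_prod n w"
    define \<rho> where "\<rho> = (1 + x) * exp (- x) - (1 - x\<^sup>2 / 2)"
    have nx: "norm x = norm w / Suc n" by (simp add: x_def norm_divide del: of_nat_Suc)
    have "norm x \<le> 1" unfolding nx using w step.hyps by (simp add: divide_le_eq)
    then have \<rho>: "norm \<rho> \<le> 4 * norm x ^ 3" unfolding \<rho>_def by (rule exp_factor_expansion)
    have G: "norm (G - 1) \<le> 5 * exp 20 * (norm w)\<^sup>2" "norm G \<le> exp 20"
      unfolding G_def using weierstrass_prod_minus_1[OF w] step.hyps by auto
    have A: "weierstrass_prod (Suc n) w = G * (1 - x\<^sup>2 / 2 + \<rho>)"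
      using step.hyps by (simp add: weierstrass_prod_def G_def x_def \<rho>_def)
    have B: "?s (Suc n) / 2 * w\<^sup>2 = ?s n / 2 * w\<^sup>2 + x\<^sup>2 / 2"
    proof -
      have "?s (Suc n) = ?s n + 1 / (real (Suc n))\<^sup>2" using step.hyps by simp
      then have "complex_of_real (?s (Suc n)) = of_real (?s n) + 1 / (of_nat (Suc n))\<^sup>2"
        by (simp only: of_real_add of_real_divide of_real_power of_real_of_nat_eq of_real_1)
      moreover have "x\<^sup>2 = 1 / (of_nat (Suc n))\<^sup>2 * w\<^sup>2"
        by (simp add: x_def power_divide)
      moreover have "of_real (a / 2) * w\<^sup>2 = of_real (b / 2) * w\<^sup>2 + x\<^sup>2 / 2"
        if "of_real a = of_real b + c" "x\<^sup>2 = c * w\<^sup>2" for a b :: real and c :: complex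
        using that by (simp add: add_divide_distrib distrib_right)
      ultimately show ?thesis by blast
    qed
    have "?R (Suc n) = ?R n + (- (x\<^sup>2 / 2) * (G - 1) + G * \<rho>)"
      unfolding A B G_def[symmetric] by (simp add: field_simps)
    also have "norm \<dots> \<le> 9 * exp 20 * norm w ^ 3 * ?s n + 9 * exp 20 * norm w ^ 3 * (1 / (real (Suc n))\<^sup>2)"
    proof (rule norm_triangle_mono)
      have "norm (- (x\<^sup>2 / 2) * (G - 1)) \<le> ((norm w)\<^sup>2 / (Suc n)\<^sup>2 / 2) * (5 * exp 20 * (norm w)\<^sup>2)"
        unfolding norm_mult norm_minus_cancel using G
        by (intro mult_mono) (simp_all add: norm_divide norm_power nx power_divide del: of_nat_Suc)
      \<comment> \<open>One factor |w| of |w|^4 is split off, since |w|/2 \<le> 1.\<close>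
      also have "\<dots> = 5 * exp 20 * norm w ^ 3 * (1 / (Suc n)\<^sup>2) * (norm w / 2)"
        by (simp add: power2_eq_square power3_eq_cube)
      also have "\<dots> \<le> 5 * exp 20 * norm w ^ 3 * (1 / (Suc n)\<^sup>2) * 1"
        using w by (intro mult_left_mono) auto
      finally have 1: "norm (- (x\<^sup>2 / 2) * (G - 1)) \<le> 5 * exp 20 * norm w ^ 3 * (1 / (real (Suc n))\<^sup>2)" by simp
      have "norm (G * \<rho>) \<le> exp 20 * (4 * norm x ^ 3)"
        unfolding norm_mult using G \<rho> by (intro mult_mono) auto
      also have "\<dots> = 4 * exp 20 * norm w ^ 3 * (1 / (real (Suc n)) ^ 3)"
        unfolding nx by (simp add: power_divide)
      also have "\<dots> \<le> 4 * exp 20 * norm w ^ 3 * (1 / (real (Suc n))\<^sup>2)"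
        by (intro mult_left_mono divide_left_mono power_increasing) auto
      finally show "norm (- (x\<^sup>2 / 2) * (G - 1) + G * \<rho>) \<le> 9 * exp 20 * norm w ^ 3 * (1 / (real (Suc n))\<^sup>2)"
        using 1 norm_triangle_ineq[of "- (x\<^sup>2 / 2) * (G - 1)" "G * \<rho>"] by linarith
    qed (rule step.IH)
    also have "\<dots> = 9 * exp 20 * norm w ^ 3 * ?s (Suc n)"
      using step.hyps by (simp add: distrib_left)
    finally show ?case .
  qed
  also have "\<dots> \<le> 9 * exp 20 * norm w ^ 3 * 1"
    using sum_inverse_squares_le[OF n] by (intro mult_left_mono) (auto intro: order.trans)
  finally show ?thesis by simp
qed

section \<open>Corrected Poisson approximation and the lower bound\<close>

lemma norm_cis_minus_1: "norm (cis t - 1) \<le> \<bar>t\<bar>"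
  using iexp_approx1[of t 0] by (simp add: cis_conv_exp)


text \<open>Dividing by n! rather than (n - 1)! averages P/n. Each factor 1 + w/j is exp (w/j) times
  a Weierstrass factor, and the exponents from j = 2 on collect to
  \<open>harm n - 1\<close>.\<close>

lemma mean_level_poly:
  assumes n: "n \<ge> 1"
  shows "(\<Sum>p\<in>attachments n. level_poly n p z) / fact n =
    exp (of_real (harm n - 1) * (z - 1)) * weierstrass_prod n (z - 1)"
proof -
  let ?w = "z - 1"
  have "(\<Prod>j=1..<n. of_nat j + z) = (\<Prod>j=2..n. of_nat j + ?w)"
    using n by (intro prod.reindex_bij_witness[of _ "\<lambda>j. j - 1" Suc]) (auto simp: of_nat_diff)
  moreover have "(fact n :: complex) = (\<Prod>j=2..n. of_nat j)"
    unfolding fact_prod of_nat_prod using n by (simp add: prod.atLeast_Suc_atMost numeral_2_eq_2)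
  ultimately have "(\<Sum>p\<in>attachments n. level_poly n p z) / fact n = (\<Prod>j=2..n. (of_nat j + ?w) / of_nat j)"
    unfolding sum_level_poly[OF n] by (simp add: prod_dividef)
  also have "\<dots> = (\<Prod>j=2..n. exp (?w / of_nat j) * ((1 + ?w / of_nat j) * exp (- (?w / of_nat j))))"
    by (intro prod.cong refl) (simp add: exp_minus field_simps)
  also have "\<dots> = exp (\<Sum>j=2..n. ?w / of_nat j) * weierstrass_prod n ?w"
    unfolding prod.distrib weierstrass_prod_def by (simp add: exp_sum)
  also have "(\<Sum>j=2..n. ?w / of_nat j) = of_real (harm n - 1) * ?w"
  proof -
    have "harm n = 1 + (\<Sum>j=2..n. inverse (of_nat j) :: complex)"
      unfolding harm_def using n by (simp add: sum.atLeast_Suc_atMost numeral_2_eq_2)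
    moreover have "(\<Sum>j=2..n. ?w / of_nat j) = ?w * (\<Sum>j=2..n. inverse (of_nat j))"
      by (simp only: divide_inverse sum_distrib_left)
    ultimately show ?thesis by (simp add: of_real_harm mult.commute)
  qed
  finally show ?thesis .
qed

text \<open>The Poisson weights minus s/2 times their second difference have the generating function
  e^(lw) (1 - s w^2/2). The deviations \<open>c k\<close> thus have e^(lw) times the cubic
  remainder, and the Fourier bound makes them O(1/l^2), below the gain of order l^(-3/2) at the
  central level. The constant 2304 is 9 times 256.\<close>

lemma mean_level_size_ge:
  assumes n: "n \<ge> 2" and l: "l = harm n - 1" and s: "s = (\<Sum>j=2..n. 1 / (real j)\<^sup>2)"
  shows "(\<Sum>p\<in>attachments n. real (level_size n p k)) / fact n \<ge>
    poisson l k * (1 + s / 2 * (k - (k - l)\<^sup>2) / l\<^sup>2) - 2304 * exp 20 / l\<^sup>2"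
proof -
  define q where "q = (\<lambda>k. (\<Sum>p\<in>attachments n. real (level_size n p k)) / fact n)"
  define r where "r = (\<lambda>k. poisson l k * ((k - l)\<^sup>2 - k) / l\<^sup>2)"
  define c where "c = (\<lambda>k. q k - (poisson l k - s / 2 * r k))"
  define f where "f = (\<lambda>t. exp (l * (cis t - 1)) * (weierstrass_prod n (cis t - 1) - (1 - s / 2 * (cis t - 1)\<^sup>2)))"
  have "harm 2 \<le> (harm n :: real)" using n by (intro harm_mono) simp
  then have l0: "l > 0" by (simp add: l harm_expand)
  have q_0: "q k = 0" if "k \<notin> {..n}" for k
    using that by (simp add: q_def level_size_eq_0)
  have q_sums: "(\<lambda>k. of_real (q k) * z ^ k) sums (exp (l * (z - 1)) * weierstrass_prod n (z - 1))" for z :: complex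
  proof -
    have "(\<Sum>k\<le>n. of_real (q k) * z ^ k) = (\<Sum>p\<in>attachments n. level_poly n p z) / fact n"
      unfolding level_poly_eq_sum_level_size q_def
      by (subst sum.swap) (simp add: sum_divide_distrib sum_distrib_right)
    also have "\<dots> = exp (l * (z - 1)) * weierstrass_prod n (z - 1)"
      using mean_level_poly[of n z] n by (simp add: l)
    finally show ?thesis
      using sums_finite[of "{..n}" "\<lambda>k. of_real (q k) * z ^ k"] q_0 by simp
  qed
  have c_sums: "(\<lambda>k. of_real (c k) * z ^ k) sums
    (exp (l * (z - 1)) * weierstrass_prod n (z - 1) - (exp (l * (z - 1)) - s / 2 * ((z - 1)\<^sup>2 * exp (l * (z - 1)))))"
    for z :: complex
  proof -
    have "(\<lambda>k. of_real (q k) * z ^ k - (of_real (poisson l k) * z ^ k - s / 2 * (of_real (r k) * z ^ k))) sums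
      (exp (l * (z - 1)) * weierstrass_prod n (z - 1) - (exp (l * (z - 1)) - s / 2 * ((z - 1)\<^sup>2 * exp (l * (z - 1)))))"
      unfolding r_def by (intro sums_diff sums_mult q_sums poisson_sums poisson_sums_second_difference l0)
    moreover have "of_real (q k) * z ^ k - (of_real (poisson l k) * z ^ k - s / 2 * (of_real (r k) * z ^ k)) =
      of_real (c k) * z ^ k" for k
      by (simp add: c_def algebra_simps)
    ultimately show ?thesis by (simp only:)
  qed
  \<comment> \<open>The series converges at z = 2, outside the unit circle, hence absolutely at z =
    1.\<close>
  have "summable (\<lambda>k. complex_of_real (c k) * of_real 2 ^ k)"
    using c_sums by (rule sums_summable)
  then have "summable (\<lambda>k. norm (complex_of_real (c k) * 1 ^ k))"
    by (rule powser_insidea) simp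
  then have "summable (\<lambda>k. norm (complex_of_real (c k)))" by simp
  then have "norm (complex_of_real (c k)) \<le> (LINT t:{-pi..pi}|lborel. norm (f t)) / (2 * pi)"
  proof (rule norm_fourier_coeff_le[of "\<lambda>k. complex_of_real (c k)" f])
    show "(\<lambda>k. complex_of_real (c k) * cis t ^ k) sums f t" for t
      using c_sums[of "cis t"] by (simp add: f_def algebra_simps)
  qed
  also have "(LINT t:{-pi..pi}|lborel. norm (f t)) \<le> (LINT t:{-pi..pi}|lborel. 9 * exp 20 * (\<bar>t\<bar> ^ 3 * exp (- l * (1 - cos t))))"
  proof (rule set_integral_mono)
    show "set_integrable lborel {-pi..pi} (\<lambda>t. norm (f t))"
      unfolding f_def weierstrass_prod_def
      by (intro borel_integrable_atLeastAtMost' continuous_intros) auto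
    show "set_integrable lborel {-pi..pi} (\<lambda>t. 9 * exp 20 * (\<bar>t\<bar> ^ 3 * exp (- l * (1 - cos t))))"
      by (intro borel_integrable_atLeastAtMost' continuous_intros)
    fix t
    have "norm (cis t - 1) \<le> 2" using norm_triangle_ineq4[of "cis t" 1] by simp
    then have "norm (weierstrass_prod n (cis t - 1) - (1 - s / 2 * (cis t - 1)\<^sup>2)) \<le> 9 * exp 20 * norm (cis t - 1) ^ 3"
      unfolding s using weierstrass_prod_expansion[of "cis t - 1" n] n by simp
    also have "\<dots> \<le> 9 * exp 20 * \<bar>t\<bar> ^ 3"
      by (intro mult_left_mono power_mono norm_cis_minus_1) auto
    finally have "norm (f t) \<le> norm (exp (l * (cis t - 1))) * (9 * exp 20 * \<bar>t\<bar> ^ 3)"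
      unfolding f_def norm_mult by (intro mult_left_mono) auto
    also have "norm (exp (l * (cis t - 1))) = exp (- l * (1 - cos t))"
      by (simp add: algebra_simps)
    finally show "norm (f t) \<le> 9 * exp 20 * (\<bar>t\<bar> ^ 3 * exp (- l * (1 - cos t)))"
      by (simp add: mult_ac)
  qed
  also have "\<dots> = 9 * exp 20 * (LINT t:{-pi..pi}|lborel. \<bar>t\<bar> ^ 3 * exp (- l * (1 - cos t)))"
    by (rule set_integral_mult_right)
  also have "\<dots> / (2 * pi) \<le> 9 * exp 20 * (256 / l\<^sup>2) / 1"
    using integral_abs_cube_le[OF l0] pi_gt3
    by (intro frac_le mult_left_mono) auto
  finally have "\<bar>c k\<bar> \<le> 2304 * exp 20 / l\<^sup>2"
    by (simp add: divide_right_mono)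
  moreover have "poisson l k * (1 + s / 2 * (k - (k - l)\<^sup>2) / l\<^sup>2) = poisson l k - s / 2 * r k"
    by (simp add: r_def algebra_simps diff_divide_distrib)
  ultimately show ?thesis unfolding c_def q_def by linarith
qed

lemma expected_width_lower:
  assumes n: "n \<ge> 10" and l: "l = harm n - 1" "l > 2"
  shows "expected_width n \<ge> n * ((1 - 1 / (4 * (l - 1))) / sqrt (2 * pi * l) * (1 + 27 / 100 * (l - 2) / l\<^sup>2) -
    2304 * exp 20 / l\<^sup>2)"
proof -
  define k where "k = nat \<lfloor>l\<rfloor>"
  define s where "s = (\<Sum>j=2..n. 1 / (real j)\<^sup>2)"
  have k: "k \<le> l" "l < k + 1" using l(2) unfolding k_def by linarith+
  \<comment> \<open>The terms up to j = 10 already push s/2 above 27/100, which exceeds the 1/4 lost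
    in Stirling's bound; hence the hypothesis n \<ge> 10.\<close>
  have "s \<ge> (\<Sum>j=2..10. 1 / (real j)\<^sup>2)"
    unfolding s_def using n by (intro sum_mono2) auto
  then have s: "s / 2 \<ge> 27 / 100" by (simp add: eval_nat_numeral)
  have "(k - l)\<^sup>2 \<le> 1" using k by (simp add: abs_square_le_1)
  \<comment> \<open>Rounding down costs at most 1 in k and at most 1 in the square.\<close>
  then have "l - 2 \<le> k - (k - l)\<^sup>2" using k by linarith
  then have "27 / 100 * (l - 2) \<le> s / 2 * (k - (k - l)\<^sup>2)"
    using s l(2) by (intro mult_mono) auto
  then have "27 / 100 * (l - 2) / l\<^sup>2 \<le> s / 2 * (k - (k - l)\<^sup>2) / l\<^sup>2"
    by (intro divide_right_mono) auto
  moreover have "(1 - 1 / (4 * (l - 1))) / sqrt (2 * pi * l) \<le> poisson l k"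
    using l(2) by (intro poisson_floor_ge) (auto simp: k_def)
  moreover have "poisson l k \<ge> 0" "27 / 100 * (l - 2) / l\<^sup>2 \<ge> 0"
    using l(2) by (simp_all add: poisson_def)
  ultimately have "(1 - 1 / (4 * (l - 1))) / sqrt (2 * pi * l) * (1 + 27 / 100 * (l - 2) / l\<^sup>2) \<le>
    poisson l k * (1 + s / 2 * (k - (k - l)\<^sup>2) / l\<^sup>2)"
    by (intro mult_mono add_left_mono) auto
  then have "(1 - 1 / (4 * (l - 1))) / sqrt (2 * pi * l) * (1 + 27 / 100 * (l - 2) / l\<^sup>2) - 2304 * exp 20 / l\<^sup>2 \<le>
    (\<Sum>p\<in>attachments n. real (level_size n p k)) / fact n"
    using mean_level_size_ge[OF _ l(1) s_def, of k] n by linarith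
  then have "n * ((1 - 1 / (4 * (l - 1))) / sqrt (2 * pi * l) * (1 + 27 / 100 * (l - 2) / l\<^sup>2) - 2304 * exp 20 / l\<^sup>2) \<le>
    n * ((\<Sum>p\<in>attachments n. real (level_size n p k)) / fact n)"
    by (intro mult_left_mono) auto
  also have "\<dots> = (\<Sum>p\<in>attachments n. real (level_size n p k)) / fact (n - 1)"
    using n fact_reduce[of n, where 'a = real] by simp
  also have "\<dots> \<le> expected_width n"
    using n by (subst expected_width_attachments)
      (auto intro!: divide_right_mono sum_mono Max_ge finite_range_level_size)
  finally show ?thesis .
qed

section \<open>Comparison of both bounds with n / sqrt(2 pi L_n)\<close>

theorem theorem1p1:
  shows "\<exists>\<epsilon> :: nat \<Rightarrow> real. \<epsilon> \<in> \<Theta>(\<lambda>n. 1 / L n) \<and>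
    (\<forall>n\<ge>1. expected_width n = real n / sqrt (2 * pi * L n) * (1 + \<epsilon> n))"
proof -
  define \<epsilon> where "\<epsilon> = (\<lambda>n. expected_width n / (real n / sqrt (2 * pi * L n)) - 1)"
  have L_ge: "L n \<ge> 1" for n by (simp add: L_def)
  have eq: "expected_width n = real n / sqrt (2 * pi * L n) * (1 + \<epsilon> n)" if "n \<ge> 1" for n
    using that L_ge[of n] by (simp add: \<epsilon>_def)
  have ln_lim: "filterlim (\<lambda>n. ln (real n)) at_top sequentially" by real_asymp
  have ev_ln: "\<forall>\<^sub>F n in sequentially. P (ln (real n))" if "\<forall>\<^sub>F x in at_top. P x" for P :: "real \<Rightarrow> bool"
    using filterlim_iff[THEN iffD1, OF ln_lim] that by blast
  have L_ev: "\<forall>\<^sub>F n in sequentially. L n = ln n \<and> n \<ge> 10 \<and> ln n > 10"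
    using eventually_ge_at_top[of 10] ev_ln[OF eventually_gt_at_top[of 10]]
    by eventually_elim (simp add: L_def)
  have "\<forall>\<^sub>F n in sequentially. \<epsilon> n \<le> 100 * (1 / L n)"
  proof -
    \<comment> \<open>The exponential term is eventually absorbed by raising 24 to 25. Replacing x -
      5/2 by x is a relative change of order 1/x, for which 100 leaves ample room.\<close>
    have "\<forall>\<^sub>F x in at_top. 1 / sqrt (2 * pi * (x - 5 / 2)) * (1 + 24 / (x - 5 / 2)) + exp (- (x - 5 / 2) / 4) \<le>
      1 / sqrt (2 * pi * x) * (1 + 100 / x)"
    proof -
      have "\<forall>\<^sub>F x::real in at_top. 1 / sqrt (x - 5 / 2) * (1 + 25 / (x - 5 / 2)) \<le> 1 / sqrt x * (1 + 100 / x)"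
        by real_asymp
      moreover have "\<forall>\<^sub>F x::real in at_top. exp (- (x - 5 / 2) / 4) * (sqrt (2 * pi * (x - 5 / 2)) * (x - 5 / 2)) \<le> 1"
        by real_asymp
      ultimately show ?thesis using eventually_gt_at_top[of 10]
      proof eventually_elim
        case (elim x)
        define l where "l = x - 5 / 2"
        have l: "l > 0" using elim by (simp add: l_def)
        have "exp (- l / 4) \<le> 1 / (sqrt (2 * pi * l) * l)"
          using elim(2) l by (simp add: l_def[symmetric] pos_le_divide_eq)
        moreover have "1 / q * (1 + 24 / l) + 1 / (q * l) = 1 / q * (1 + 25 / l)" for q
          using l by (simp add: divide_simps)
        ultimately have "1 / sqrt (2 * pi * l) * (1 + 24 / l) + exp (- l / 4) \<le> 1 / sqrt (2 * pi * l) * (1 + 25 / l)"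
          by (metis add_left_mono)
        also have "\<dots> = 1 / sqrt (2 * pi) * (1 / sqrt l * (1 + 25 / l))"
          by (simp add: real_sqrt_mult)
        also have "\<dots> \<le> 1 / sqrt (2 * pi) * (1 / sqrt x * (1 + 100 / x))"
          using elim(1) unfolding l_def by (intro mult_left_mono) auto
        also have "\<dots> = 1 / sqrt (2 * pi * x) * (1 + 100 / x)"
          by (simp add: real_sqrt_mult)
        finally show ?case by (simp add: l_def)
      qed
    qed
    from ev_ln[OF this] show ?thesis using L_ev
    proof eventually_elim
      case (elim n)
      have n: "n \<ge> 1" and L: "L n = ln n" using elim by auto
      have "expected_width n \<le> n * (1 / sqrt (2 * pi * (ln n - 5 / 2)) * (1 + 24 / (ln n - 5 / 2)) + exp (- (ln n - 5 / 2) / 4))"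
        using elim by (intro expected_width_upper[OF n refl]) simp
      also have "\<dots> \<le> n * (1 / sqrt (2 * pi * L n) * (1 + 100 / L n))"
        unfolding L by (intro mult_left_mono elim(1)) simp
      finally have "real n / sqrt (2 * pi * L n) * (1 + \<epsilon> n) \<le> real n / sqrt (2 * pi * L n) * (1 + 100 / L n)"
        unfolding eq[OF n] by simp
      moreover have "real n / sqrt (2 * pi * L n) > 0" using elim by simp
      ultimately show ?case by (simp only: mult_le_cancel_left_pos)
    qed
  qed
  moreover have "\<forall>\<^sub>F n in sequentially. \<epsilon> n \<ge> 1 / 100 * (1 / L n)"
  proof -
    have harm_lim: "filterlim (\<lambda>n. harm n - 1 :: real) at_top sequentially"
      using filterlim_tendsto_add_at_top[OF tendsto_const[of "- 1"] harm_at_top] by simp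
    define K :: real where "K = 2304 * exp 20"
    define B where "B = (\<lambda>l::real. (1 - 1 / (4 * (l - 1))) / sqrt (2 * pi * l) * (1 + 27 / 100 * (l - 2) / l\<^sup>2) - K / l\<^sup>2)"
    have "\<forall>\<^sub>F l in at_top. l > 2 \<and> 1 / sqrt (2 * pi * l) * (1 + 1 / 100 / l) \<le> B l"
    proof -
      \<comment> \<open>The coefficient of 1/l on the right is 27/100 - 1/4 = 2/100. It leaves the
        claimed 1/100 and a spare 1/1000 to pay for the error K/l^2.\<close>
      have "\<forall>\<^sub>F l::real in at_top. 1 + 1 / 100 / l + 1 / 1000 / l \<le> (1 - 1 / (4 * (l - 1))) * (1 + 27 / 100 * (l - 2) / l\<^sup>2)"
        by real_asymp
      moreover have "\<forall>\<^sub>F l in at_top. K * (sqrt (2 * pi * l) / l) < 1 / 1000"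
      proof (rule order_tendstoD(2))
        have "((\<lambda>l. sqrt (2 * pi * l) / l) \<longlongrightarrow> 0) at_top" by real_asymp
        then show "((\<lambda>l. K * (sqrt (2 * pi * l) / l)) \<longlongrightarrow> 0) at_top" by (rule tendsto_mult_right_zero)
      qed simp
      ultimately show ?thesis using eventually_gt_at_top[of 2]
      proof eventually_elim
        case (elim l)
        define q where "q = sqrt (2 * pi * l)"
        have q: "q > 0" using elim by (simp add: q_def)
        have "K * (q / l) / (q * l) \<le> 1 / 1000 / (q * l)"
          using elim q unfolding q_def by (intro divide_right_mono) auto
        moreover have "K * (q / l) / (q * l) = K / l\<^sup>2"
          using q by (simp add: power2_eq_square)
        moreover have "(1 + 1 / 100 / l + 1 / 1000 / l) / q \<le>
          (1 - 1 / (4 * (l - 1))) * (1 + 27 / 100 * (l - 2) / l\<^sup>2) / q"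
          using elim(1) q by (intro divide_right_mono) auto
        moreover have "(1 + 1 / 100 / l + 1 / 1000 / l) / q = 1 / q * (1 + 1 / 100 / l) + 1 / 1000 / (q * l)"
          by (simp add: add_divide_distrib mult.commute)
        ultimately show ?case
          using elim(3) unfolding B_def q_def[symmetric] times_divide_eq_left by linarith
      qed
    qed
    from filterlim_iff[THEN iffD1, OF harm_lim, rule_format, OF this] show ?thesis using L_ev
    proof eventually_elim
      case (elim n)
      define l where "l = (harm n - 1 :: real)"
      \<comment> \<open>The sequence \<open>harm n - ln n\<close> decreases from its value 1 at n =
        1, so l \<le> ln n. The bound in l is decreasing, hence it survives replacing l by the
        larger \<open>L n\<close>.\<close>
      have l: "l > 2" "l \<le> L n"
        using elim(1,2) euler_mascheroni_sequence_decreasing[of 1 n] by (auto simp: l_def harm_expand)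
      have "1 / sqrt (2 * pi * L n) * (1 + 1 / 100 / L n) \<le> 1 / sqrt (2 * pi * l) * (1 + 1 / 100 / l)"
        using l by (intro mult_mono add_left_mono divide_left_mono) auto
      also have "\<dots> \<le> B l"
        using elim(1) unfolding l_def by blast
      finally have "real n * (1 / sqrt (2 * pi * L n) * (1 + 1 / 100 / L n)) \<le> real n * B l"
        by (rule mult_left_mono) simp
      also have "\<dots> \<le> expected_width n"
        unfolding B_def K_def using elim(2) by (intro expected_width_lower l_def l(1)) simp
      finally have "real n / sqrt (2 * pi * L n) * (1 + 1 / 100 / L n) \<le> real n / sqrt (2 * pi * L n) * (1 + \<epsilon> n)"
        using eq[of n] elim(2) by simp
      moreover have "real n / sqrt (2 * pi * L n) > 0" using elim by simp
      ultimately show ?case by (simp only: mult_le_cancel_left_pos)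
    qed
  qed
  ultimately have "\<forall>\<^sub>F n in sequentially. norm (\<epsilon> n) \<le> 100 * norm (1 / L n) \<and> norm (\<epsilon> n) \<ge> 1 / 100 * norm (1 / L n)"
  proof eventually_elim
    case (elim n)
    have "1 / L n > 0" using L_ge[of n] by simp
    then show ?case using elim by simp
  qed
  then have "\<epsilon> \<in> \<Theta>(\<lambda>n. 1 / L n)"
    by (intro bigthetaI landau_o.bigI[of 100] landau_omega.bigI[of "1 / 100"])
      (auto elim: eventually_mono)
  then show ?thesis using eq by blast
qed

end
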